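(* Let $(\mathcal{M},d,0)$ be a pointed metric space. There exists a bounded metric space $\mathcal{B}$ with $\mathcal{F}_p(\mathcal{M})\simeq\mathcal{F}_p(\mathcal{B})$ for all $p\in(0,1]$. More specifically, let $\alpha\colon(0,\infty)\to(0,\infty)$ be a Lipschitz function with $D(\alpha)<\infty$. Then $\mathcal{B}=\mathcal{B}(\mathcal{M},\alpha)$ is bounded and, for each $p\in(0,1]$, the linear operator $P_\alpha^F\colon\mathcal{F}_p(\mathcal{M})\to\mathcal{F}_p(\mathcal{B}(\mathcal{M},\alpha))$ defined by $$P_\alpha^F(\delta_{\mathcal{M}}(x))=\zeta(x)\,\delta_{\mathcal{B}}(\mu(x)),\quad x\in\mathcal{M}\setminus\{0\},$$ induces an isomorphism whose inverse $Q_\alpha^F\colon\mathcal{F}_p(\mathcal{B}(\mathcal{M},\alpha))\to\mathcal{F}_p(\mathcal{M})$ is given by $$Q_\alpha^F(\delta_{\mathcal{B}}(\mu(x)))=\frac{\delta_{\mathcal{M}}(x)}{\zeta(x)},\quad x\in\mathcal{M}\setminus\{0\}.$$ Moreover $\|P_\alpha^F\|\,\|Q_\alpha^F\|\le C$, where $C=1+2K(\alpha)$ if $p=1$ and $C=(1+K(\alpha)^p)^{1/p}(1+2K(\alpha)^p)^{1/p}$ if $p<1$.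
   Context: The scalar field is $\mathbb{R}$ or $\mathbb{C}$. A pointed metric space is a metric space with a distinguished point $0$. For $0<p\le1$, a $p$-Banach space is a vector space $X$ which is complete under a map $\|\cdot\|_X$ with the properties of a norm except that the triangle inequality is replaced by $\|u+v\|_X^p\le\|u\|_X^p+\|v\|_X^p$. The Lipschitz-free $p$-space $\mathcal{F}_p(\mathcal{M})$ is the completion of $\mathrm{span}\{\delta_{\mathcal{M}}(x)\colon x\in\mathcal{M}\setminus\{0\}\}$ (finitely supported scalar functions on $\mathcal{M}\setminus\{0\}$, $\delta_{\mathcal{M}}(x)$ being the characteristic function of $\{x\}$, $\delta_{\mathcal{M}}(0)=0$) in the $p$-norm $\|\sum_i a_i\delta_{\mathcal{M}}(x_i)\|=\sup\|\sum_i a_i f(x_i)\|_X$, the supremum being over all $p$-Banach spaces $X$ and all $1$-Lipschitz $f\colon\mathcal{M}\to X$ with $f(0)=0$. Write $\mathcal{F}(\mathcal{M})=\mathcal{F}_1(\mathcal{M})$. The symbol $\simeq$ denotes linear isomorphism (bounded linear bijection with bounded inverse). $\mathrm{Lip}(\alpha)$ is the least Lipschitz constant of $\alpha$, $D(\alpha)=\sup_{t>0}t/\alpha(t)$, and $K(\alpha)=\mathrm{Lip}(\alpha)D(\alpha)$. Put $\zeta(0)=0$, $\zeta(x)=\alpha(d(0,x))$ for $x\ne0$; $\mu(0)=0$, $\mu(x)=\delta_{\mathcal{M}}(x)/\zeta(x)\in\mathcal{F}(\mathcal{M})$ for $x\neq0$. $\mathcal{B}(\mathcal{M},\alpha)=\{\mu(x)\colon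 x\in\mathcal{M}\}\subset\mathcal{F}(\mathcal{M})$ with the metric induced by the norm of $\mathcal{F}(\mathcal{M})$ and base point $0$; $\delta_{\mathcal{B}}$ denotes the corresponding map into $\mathcal{F}_p(\mathcal{B}(\mathcal{M},\alpha))$. *)

theory Defs
  imports "HOL-Analysis.Analysis" "HOL-Algebra.Algebraic_Closure_Type"
begin

(* The scalars are a type 'k of class real_normed_field; by Gelfand-Mazur such a field is the reals
   or the complex numbers, up to isometric isomorphism.  A vector space over 'k is a module over
   ring_of_type_algebra :: 'k ring; the ring multiplication and unit that the record of modules
   inherits are never used. *)

record ('k, 'v) normed_module = "('k, 'v) module" +
  vnorm :: "'v \<Rightarrow> real"

definition Cauchy_seq :: "('k, 'v) normed_module \<Rightarrow> (nat \<Rightarrow> 'v) \<Rightarrow> bool" where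
  "Cauchy_seq E s \<longleftrightarrow> (\<forall>n. s n \<in> carrier E) \<and>
     (\<forall>e>0. \<exists>N. \<forall>m\<ge>N. \<forall>n\<ge>N. vnorm E (s m \<ominus>\<^bsub>E\<^esub> s n) < e)"

definition complete_module :: "('k, 'v) normed_module \<Rightarrow> bool" where
  "complete_module E \<longleftrightarrow>
     (\<forall>s. Cauchy_seq E s \<longrightarrow> (\<exists>u\<in>carrier E. (\<lambda>n. vnorm E (s n \<ominus>\<^bsub>E\<^esub> u)) \<longlonglongrightarrow> 0))"

definition p_Banach_space :: "real \<Rightarrow> ('k::real_normed_field, 'v) normed_module \<Rightarrow> bool" where
  "p_Banach_space p E \<longleftrightarrow>
     module (ring_of_type_algebra :: 'k ring) E \<and>
     (\<forall>u\<in>carrier E. 0 \<le> vnorm E u) \<and>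
     (\<forall>u\<in>carrier E. vnorm E u = 0 \<longleftrightarrow> u = \<zero>\<^bsub>E\<^esub>) \<and>
     (\<forall>c. \<forall>u\<in>carrier E. vnorm E (c \<odot>\<^bsub>E\<^esub> u) = norm c * vnorm E u) \<and>
     (\<forall>u\<in>carrier E. \<forall>v\<in>carrier E.
        vnorm E (u \<oplus>\<^bsub>E\<^esub> v) powr p \<le> vnorm E u powr p + vnorm E v powr p) \<and>
     complete_module E"

definition norm_dist :: "('k, 'v) normed_module \<Rightarrow> 'v \<Rightarrow> 'v \<Rightarrow> real" where
  (* set to 0 off the carrier only because Metric_space asks for a total symmetric function *)
  "norm_dist E u v = (if u \<in> carrier E \<and> v \<in> carrier E then vnorm E (u \<ominus>\<^bsub>E\<^esub> v) else 0)"


definition bounded_operator ::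
    "('k, 'v) normed_module \<Rightarrow> ('k, 'w) normed_module \<Rightarrow> ('v \<Rightarrow> 'w) \<Rightarrow> bool" where
  "bounded_operator E Y T \<longleftrightarrow>
     T \<in> carrier E \<rightarrow> carrier Y \<and>
     (\<forall>u\<in>carrier E. \<forall>v\<in>carrier E. T (u \<oplus>\<^bsub>E\<^esub> v) = T u \<oplus>\<^bsub>Y\<^esub> T v) \<and>
     (\<forall>c. \<forall>u\<in>carrier E. T (c \<odot>\<^bsub>E\<^esub> u) = c \<odot>\<^bsub>Y\<^esub> T u) \<and>
     (\<exists>C. \<forall>u\<in>carrier E. vnorm Y (T u) \<le> C * vnorm E u)"

definition operator_norm ::
    "('k, 'v) normed_module \<Rightarrow> ('k, 'w) normed_module \<Rightarrow> ('v \<Rightarrow> 'w) \<Rightarrow> real" where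
  "operator_norm E Y T = (SUP u\<in>{u \<in> carrier E. vnorm E u \<le> 1}. vnorm Y (T u))"

definition isomorphic ::
    "('k, 'v) normed_module \<Rightarrow> ('k, 'w) normed_module \<Rightarrow> bool" where
  "isomorphic E Y \<longleftrightarrow> (\<exists>T. bounded_operator E Y T \<and> bij_betw T (carrier E) (carrier Y) \<and>
     bounded_operator Y E (inv_into (carrier E) T))"

definition unique_bounded_operator ::
    "('k, 'v) normed_module \<Rightarrow> ('k, 'w) normed_module \<Rightarrow>
     'i set \<Rightarrow> ('i \<Rightarrow> 'v) \<Rightarrow> ('i \<Rightarrow> 'w) \<Rightarrow> ('v \<Rightarrow> 'w) \<Rightarrow> bool" where
  (* T is the bounded operator defined by T (e i) = g i; functions are total, so T is determined
     on the carrier only *)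
  "unique_bounded_operator E Y I e g T \<longleftrightarrow>
     bounded_operator E Y T \<and> (\<forall>i\<in>I. T (e i) = g i) \<and>
     (\<forall>T'. bounded_operator E Y T' \<and> (\<forall>i\<in>I. T' (e i) = g i) \<longrightarrow>
        (\<forall>u\<in>carrier E. T' u = T u))"


definition null_rel :: "('k, 'v) normed_module \<Rightarrow> ((nat \<Rightarrow> 'v) \<times> (nat \<Rightarrow> 'v)) set" where
  "null_rel E = {(s, t). Cauchy_seq E s \<and> Cauchy_seq E t \<and>
     (\<lambda>n. vnorm E (s n \<ominus>\<^bsub>E\<^esub> t n)) \<longlonglongrightarrow> 0}"

definition representative :: "(nat \<Rightarrow> 'v) set \<Rightarrow> nat \<Rightarrow> 'v" where
  "representative A = (SOME s. s \<in> A)"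

definition completion ::
    "('k, 'v) normed_module \<Rightarrow> ('k, (nat \<Rightarrow> 'v) set) normed_module" where
  "completion E = \<lparr>
     carrier = {s. Cauchy_seq E s} // null_rel E,
     mult = undefined,
     one = undefined,
     zero = null_rel E `` {\<lambda>n. \<zero>\<^bsub>E\<^esub>},
     add = (\<lambda>A B. null_rel E `` {\<lambda>n. representative A n \<oplus>\<^bsub>E\<^esub> representative B n}),
     smult = (\<lambda>c A. null_rel E `` {\<lambda>n. c \<odot>\<^bsub>E\<^esub> representative A n}),
     vnorm = (\<lambda>A. lim (\<lambda>n. vnorm E (representative A n))) \<rparr>"

definition to_completion :: "('k, 'v) normed_module \<Rightarrow> 'v \<Rightarrow> (nat \<Rightarrow> 'v) set" where
  "to_completion E u = null_rel E `` {\<lambda>n. u}"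


(* In the following, (M, d) is a metric space with distinguished point b. *)

definition free_norm ::
    "real \<Rightarrow> 'm set \<Rightarrow> ('m \<Rightarrow> 'm \<Rightarrow> real) \<Rightarrow> 'm \<Rightarrow> ('m \<Rightarrow> 'k::real_normed_field) \<Rightarrow> real" where
  (* The supremum ranges over the p-Banach spaces E whose vectors are elements of the type
     (nat => 'm => 'k) set.  This loses nothing: given any p-Banach space and f, the norms of the
     sums only involve the closed span of the range of f, and mapping u to the set of all
     sequences s of finitely supported functions such that the sums of s n x . f x over x converge
     to u is injective on that closed span; transport its structure along this map. *)
  "free_norm p M d b a =
     Sup {vnorm E (\<Oplus>\<^bsub>E\<^esub>x\<in>{x. a x \<noteq> 0}. a x \<odot>\<^bsub>E\<^esub> f x) |
       (E :: ('k, (nat \<Rightarrow> 'm \<Rightarrow> 'k) set) normed_module) f.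
       p_Banach_space p E \<and> f \<in> M \<rightarrow> carrier E \<and> f b = \<zero>\<^bsub>E\<^esub> \<and>
       (\<forall>x\<in>M. \<forall>y\<in>M. vnorm E (f x \<ominus>\<^bsub>E\<^esub> f y) \<le> d x y)}"

definition finite_free_space ::
    "real \<Rightarrow> 'm set \<Rightarrow> ('m \<Rightarrow> 'm \<Rightarrow> real) \<Rightarrow> 'm \<Rightarrow>
     ('k::real_normed_field, 'm \<Rightarrow> 'k) normed_module" where
  "finite_free_space p M d b = \<lparr>
     carrier = {a. finite {x. a x \<noteq> 0} \<and> {x. a x \<noteq> 0} \<subseteq> M - {b}},
     mult = undefined,
     one = undefined,
     zero = (\<lambda>x. 0),
     add = (\<lambda>a a' x. a x + a' x),
     smult = (\<lambda>c a x. c * a x),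
     vnorm = free_norm p M d b \<rparr>"

definition free_space ::
    "real \<Rightarrow> 'm set \<Rightarrow> ('m \<Rightarrow> 'm \<Rightarrow> real) \<Rightarrow> 'm \<Rightarrow>
     ('k::real_normed_field, (nat \<Rightarrow> 'm \<Rightarrow> 'k) set) normed_module" where
  "free_space p M d b = completion (finite_free_space p M d b)"

definition delta ::
    "real \<Rightarrow> 'm set \<Rightarrow> ('m \<Rightarrow> 'm \<Rightarrow> real) \<Rightarrow> 'm \<Rightarrow> 'm \<Rightarrow>
     (nat \<Rightarrow> 'm \<Rightarrow> 'k::real_normed_field) set" where
  "delta p M d b x = to_completion (finite_free_space p M d b)
     (if x = b then (\<lambda>y. 0) else (\<lambda>y. if y = x then 1 else 0))"


definition Lip_const :: "(real \<Rightarrow> real) \<Rightarrow> real" where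
  "Lip_const \<alpha> = Inf {L. L-lipschitz_on {0<..} \<alpha>}"

definition D_const :: "(real \<Rightarrow> real) \<Rightarrow> real" where
  (* meaningful only if the set of the quotients is bounded above *)
  "D_const \<alpha> = (SUP t\<in>{0<..}. t / \<alpha> t)"

definition K_const :: "(real \<Rightarrow> real) \<Rightarrow> real" where
  "K_const \<alpha> = Lip_const \<alpha> * D_const \<alpha>"

definition zeta :: "('m \<Rightarrow> 'm \<Rightarrow> real) \<Rightarrow> 'm \<Rightarrow> (real \<Rightarrow> real) \<Rightarrow> 'm \<Rightarrow> real" where
  "zeta d b \<alpha> x = (if x = b then 0 else \<alpha> (d b x))"

definition mu ::
    "'m set \<Rightarrow> ('m \<Rightarrow> 'm \<Rightarrow> real) \<Rightarrow> 'm \<Rightarrow> (real \<Rightarrow> real) \<Rightarrow> 'm \<Rightarrow>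
     (nat \<Rightarrow> 'm \<Rightarrow> 'k::real_normed_field) set" where
  "mu M d b \<alpha> x = (let F = free_space 1 M d b in
     if x = b then \<zero>\<^bsub>F\<^esub> else of_real (1 / zeta d b \<alpha> x) \<odot>\<^bsub>F\<^esub> delta 1 M d b x)"

definition B_set ::
    "'m set \<Rightarrow> ('m \<Rightarrow> 'm \<Rightarrow> real) \<Rightarrow> 'm \<Rightarrow> (real \<Rightarrow> real) \<Rightarrow>
     (nat \<Rightarrow> 'm \<Rightarrow> 'k::real_normed_field) set set" where
  "B_set M d b \<alpha> = mu M d b \<alpha> ` M"

definition C_const :: "real \<Rightarrow> (real \<Rightarrow> real) \<Rightarrow> real" where
  "C_const p \<alpha> = (if p = 1 then 1 + 2 * K_const \<alpha>
     else (1 + K_const \<alpha> powr p) powr (1 / p) * (1 + 2 * K_const \<alpha> powr p) powr (1 / p))"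

end

theory Submission
  imports Defs
begin

text \<open>
  The isomorphism comes from the universal property of \<open>F\<^sub>p(M)\<close>: a Lipschitz map \<open>g\<close> from \<open>M\<close> into a
  \<open>p\<close>-Banach space with \<open>g b = 0\<close> has a unique bounded linear extension along \<open>delta\<close>, and the norm of
  the extension is at most any positive Lipschitz constant of \<open>g\<close>.

  To get this property for target spaces of arbitrary type, note that the norm on finitely supported
  functions is the largest \<open>p\<close>-seminorm \<open>N\<close> with \<open>N (\<delta> x - \<delta> y) \<le> d x y\<close>
  (\<open>vnorm_lincomb_le_free_norm\<close>). Indeed, the finitely supported functions completed with respect to
  such an \<open>N\<close> form one of the \<open>p\<close>-Banach spaces over which the supremum in \<open>free_norm\<close> is taken
  (\<open>p_Banach_realization\<close>). Given \<open>g\<close> with values anywhere, the seminorm pulled back along the linear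
  extension of \<open>g\<close> is therefore dominated by the free norm, and \<open>lipschitz_extension\<close> follows by density.

  The operators \<open>P\<close> and \<open>Q\<close> extend \<open>x \<mapsto> \<zeta> x \<cdot> \<delta>\<^sub>B (\<mu> x)\<close> and \<open>\<mu> x \<mapsto> \<delta>\<^sub>M x / \<zeta> x\<close>. Both Lipschitz
  estimates rest on \<open>c u - e v = c (u - v) + (c - e) v\<close>, where the second term is controlled by
  \<open>|\<zeta> x - \<zeta> y| \<cdot> d y b / \<zeta> y \<le> K \<cdot> d x y\<close> (\<open>zeta_diff_bound\<close>). For \<open>P\<close> this gives the constant
  \<open>(1 + 2 K\<^sup>p)\<^bsup>1/p\<^esup>\<close>, because \<open>\<zeta> x \<cdot> \<parallel>\<mu> x - \<mu> y\<parallel> \<le> (1 + K) \<cdot> d x y\<close>. For \<open>Q\<close> one also needs a lower bound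
  for the distance in \<open>B\<close>; by symmetry let \<open>1 / \<zeta> x \<le> 1 / \<zeta> y\<close>. Testing against the \<open>1\<close>-Lipschitz function
  \<open>z \<mapsto> d z y - d b y\<close> yields \<open>\<parallel>\<mu> x - \<mu> y\<parallel> \<ge> d x y / \<zeta> x\<close>, and the constant is \<open>(1 + K\<^sup>p)\<^bsup>1/p\<^esup>\<close>. If \<open>p = 1\<close>
  the map defining \<open>Q\<close> is an isometric embedding, so its constant is \<open>1\<close>. The extensions are mutually
  inverse because they are on the vectors \<open>\<delta> x\<close>, which determine a bounded operator.
\<close>

section \<open>Modules with a p-seminorm\<close>

lemma ring_of_type_algebra_simps [simp]:
  "carrier (ring_of_type_algebra :: 'k::comm_ring_1 ring) = UNIV"
  "\<one>\<^bsub>(ring_of_type_algebra :: 'k ring)\<^esub> = 1"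
  "\<zero>\<^bsub>(ring_of_type_algebra :: 'k ring)\<^esub> = 0"
  "x \<oplus>\<^bsub>(ring_of_type_algebra :: 'k ring)\<^esub> y = x + y"
  "x \<otimes>\<^bsub>(ring_of_type_algebra :: 'k ring)\<^esub> y = x * y"
  by (simp_all add: ring_of_type_algebra_def)

lemma tendsto_powr_iff:
  fixes f :: "nat \<Rightarrow> real"
  assumes "0 < p" "\<And>n. 0 \<le> f n" "0 \<le> l"
  shows "(\<lambda>n. f n powr p) \<longlonglongrightarrow> l powr p \<longleftrightarrow> f \<longlonglongrightarrow> l"
proof
  assume "(\<lambda>n. f n powr p) \<longlonglongrightarrow> l powr p"
  then have "(\<lambda>n. (f n powr p) powr (1 / p)) \<longlonglongrightarrow> (l powr p) powr (1 / p)"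
    using assms by (rule_tac tendsto_powr2) auto
  moreover have "(x powr p) powr (1 / p) = x" if "0 \<le> x" for x :: real
    using that assms(1) by (simp add: powr_powr)
  ultimately show "f \<longlonglongrightarrow> l"
    using assms(2,3) by (simp only:)
next
  assume "f \<longlonglongrightarrow> l"
  then show "(\<lambda>n. f n powr p) \<longlonglongrightarrow> l powr p"
    using assms by (intro tendsto_powr2) auto
qed

lemma tendsto_0_powr_iff:
  fixes f :: "nat \<Rightarrow> real"
  assumes "0 < p" "\<And>n. 0 \<le> f n"
  shows "(\<lambda>n. f n powr p) \<longlonglongrightarrow> 0 \<longleftrightarrow> f \<longlonglongrightarrow> 0"
  using tendsto_powr_iff[OF assms, of 0] by simp

lemma powr_less_iff_less_powr_inverse:
  fixes x :: real
  assumes "0 < p" "0 \<le> x" "0 < e"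
  shows "x powr p < e \<longleftrightarrow> x < e powr (1 / p)"
proof -
  have "x powr p < e \<longleftrightarrow> x powr p < (e powr (1 / p)) powr p"
    using assms by (simp add: powr_powr)
  also have "\<dots> \<longleftrightarrow> x < e powr (1 / p)"
    using assms by (meson linorder_not_less powr_ge_zero powr_less_mono2 powr_mono2 less_imp_le)
  finally show ?thesis .
qed

lemma powr_le_iff_le:
  fixes x :: real
  assumes "0 < p" "0 \<le> x" "0 \<le> y"
  shows "x powr p \<le> y powr p \<longleftrightarrow> x \<le> y"
  using assms by (meson linorder_not_less powr_less_mono2 powr_mono2 less_imp_le)

locale p_seminormed =
  fixes p :: real and E :: "('k::real_normed_field, 'v) normed_module" (structure)
  assumes p_pos: "0 < p"
    and is_module: "module (ring_of_type_algebra :: 'k ring) E"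
    and vnorm_nonneg [simp]: "u \<in> carrier E \<Longrightarrow> 0 \<le> vnorm E u"
    and vnorm_smult: "u \<in> carrier E \<Longrightarrow> vnorm E (c \<odot> u) = norm c * vnorm E u"
    and vnorm_add_powr: "u \<in> carrier E \<Longrightarrow> v \<in> carrier E \<Longrightarrow>
      vnorm E (u \<oplus> v) powr p \<le> vnorm E u powr p + vnorm E v powr p"
begin

sublocale module "ring_of_type_algebra :: 'k ring" E
  by (rule is_module)

lemma vnorm_zero [simp]: "vnorm E \<zero> = 0"
  using vnorm_smult[of "\<zero>" 0] smult_l_null[of "\<zero>"] by simp

lemma minus_eq_smult: "u \<in> carrier E \<Longrightarrow> \<ominus> u = (- 1) \<odot> u"
  using smult_l_distr[of "- 1" 1 u] smult_l_null[of u] smult_one[of u]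
  by (intro minus_equality) auto

lemma vnorm_minus [simp]: "u \<in> carrier E \<Longrightarrow> vnorm E (\<ominus> u) = vnorm E u"
  by (simp add: minus_eq_smult vnorm_smult)

lemma minus_self [simp]: "u \<in> carrier E \<Longrightarrow> u \<ominus> u = \<zero>"
  by (simp add: a_minus_def r_neg)

lemma minus_zero_right [simp]: "u \<in> carrier E \<Longrightarrow> u \<ominus> \<zero> = u"
  by (simp add: a_minus_def)

lemma add_minus_add:
  assumes "u \<in> carrier E" "v \<in> carrier E" "u' \<in> carrier E" "v' \<in> carrier E"
  shows "(u \<oplus> v) \<ominus> (u' \<oplus> v') = (u \<ominus> u') \<oplus> (v \<ominus> v')"
  using assms by (simp add: a_minus_def minus_add a_ac)

lemma smult_minus:
  assumes "u \<in> carrier E" "v \<in> carrier E"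
  shows "c \<odot> (u \<ominus> v) = c \<odot> u \<ominus> c \<odot> v"
  using assms by (simp add: a_minus_def smult_r_distr smult_r_minus)

lemma minus_eq_add_minus:
  assumes "u \<in> carrier E" "v \<in> carrier E" "w \<in> carrier E"
  shows "u \<ominus> w = (u \<ominus> v) \<oplus> (v \<ominus> w)"
  using assms by (simp add: a_minus_def a_assoc r_neg1)

lemma minus_swap:
  assumes "u \<in> carrier E" "v \<in> carrier E"
  shows "u \<ominus> v = \<ominus> (v \<ominus> u)"
  using assms by (simp add: a_minus_def minus_add a_comm)

lemma vnorm_minus_commute:
  assumes "u \<in> carrier E" "v \<in> carrier E"
  shows "vnorm E (u \<ominus> v) = vnorm E (v \<ominus> u)"
  using assms by (simp add: minus_swap[of u v])

lemma vnorm_diff_triangle: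
  assumes "u \<in> carrier E" "v \<in> carrier E" "w \<in> carrier E"
  shows "vnorm E (u \<ominus> w) powr p \<le> vnorm E (u \<ominus> v) powr p + vnorm E (v \<ominus> w) powr p"
  using assms by (subst minus_eq_add_minus[of u v w]) (auto intro: vnorm_add_powr)

text \<open>
  The map \<open>u \<mapsto> \<parallel>u\<parallel>\<^sup>p\<close> is subadditive, so it obeys the reverse triangle inequality that \<open>\<parallel>u\<parallel>\<close> itself may
  violate for \<open>p < 1\<close>. This is why continuity and Cauchy arguments below are carried out for \<open>p\<close>-th
  powers and transferred back by taking roots.
\<close>

lemma abs_vnorm_powr_diff_le:
  assumes "u \<in> carrier E" "v \<in> carrier E"
  shows "\<bar>vnorm E u powr p - vnorm E v powr p\<bar> \<le> vnorm E (u \<ominus> v) powr p"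
  using vnorm_diff_triangle[of u v "\<zero>"] vnorm_diff_triangle[of v u "\<zero>"] assms
  by (simp add: vnorm_minus_commute[of v u] abs_le_iff)

lemma vnorm_powr_tendsto_0_iff:
  assumes "\<And>n. s n \<in> carrier E"
  shows "(\<lambda>n. vnorm E (s n) powr p) \<longlonglongrightarrow> 0 \<longleftrightarrow> (\<lambda>n. vnorm E (s n)) \<longlonglongrightarrow> 0"
  using assms p_pos by (intro tendsto_0_powr_iff) auto

lemma vnorm_add_tendsto_0:
  assumes "\<And>n. s n \<in> carrier E" "\<And>n. t n \<in> carrier E"
    and "(\<lambda>n. vnorm E (s n)) \<longlonglongrightarrow> 0" "(\<lambda>n. vnorm E (t n)) \<longlonglongrightarrow> 0"
  shows "(\<lambda>n. vnorm E (s n \<oplus> t n)) \<longlonglongrightarrow> 0"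
proof -
  have "(\<lambda>n. vnorm E (s n) powr p + vnorm E (t n) powr p) \<longlonglongrightarrow> 0 + 0"
    using assms by (intro tendsto_add) (simp_all add: vnorm_powr_tendsto_0_iff)
  then have "(\<lambda>n. vnorm E (s n) powr p + vnorm E (t n) powr p) \<longlonglongrightarrow> 0"
    by simp
  then have "(\<lambda>n. vnorm E (s n \<oplus> t n) powr p) \<longlonglongrightarrow> 0"
    by (rule Lim_null_comparison[rotated]) (use assms vnorm_add_powr in auto)
  then show ?thesis
    using assms by (simp add: vnorm_powr_tendsto_0_iff)
qed

lemma vnorm_diff_trans_tendsto_0:
  assumes "\<And>n. s n \<in> carrier E" "\<And>n. t n \<in> carrier E" "\<And>n. r n \<in> carrier E"
    and "(\<lambda>n. vnorm E (s n \<ominus> t n)) \<longlonglongrightarrow> 0" "(\<lambda>n. vnorm E (t n \<ominus> r n)) \<longlonglongrightarrow> 0"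
  shows "(\<lambda>n. vnorm E (s n \<ominus> r n)) \<longlonglongrightarrow> 0"
  using vnorm_add_tendsto_0[of "\<lambda>n. s n \<ominus> t n" "\<lambda>n. t n \<ominus> r n"] assms
  by (simp add: minus_eq_add_minus[symmetric])

lemma Cauchy_seqI:
  assumes "\<And>n. s n \<in> carrier E"
    and "\<And>e. 0 < e \<Longrightarrow> \<exists>N. \<forall>m\<ge>N. \<forall>n\<ge>N. vnorm E (s m \<ominus> s n) powr p < e"
  shows "Cauchy_seq E s"
  unfolding Cauchy_seq_def
proof (intro conjI allI impI assms(1))
  fix e :: real assume "0 < e"
  then obtain N where "\<forall>m\<ge>N. \<forall>n\<ge>N. vnorm E (s m \<ominus> s n) powr p < e powr p"
    using assms(2)[of "e powr p"] by auto
  moreover have "vnorm E (s m \<ominus> s n) powr p < e powr p \<longleftrightarrow> vnorm E (s m \<ominus> s n) < e" for m n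
    using assms(1) p_pos \<open>0 < e\<close>
    by (subst powr_less_iff_less_powr_inverse) (auto simp: powr_powr)
  ultimately show "\<exists>N. \<forall>m\<ge>N. \<forall>n\<ge>N. vnorm E (s m \<ominus> s n) < e"
    by blast
qed

lemma Cauchy_seqD:
  assumes "Cauchy_seq E s" "0 < e"
  shows "\<exists>N. \<forall>m\<ge>N. \<forall>n\<ge>N. vnorm E (s m \<ominus> s n) powr p < e"
proof -
  have s: "s n \<in> carrier E" for n
    using assms unfolding Cauchy_seq_def by blast
  have "vnorm E (s m \<ominus> s n) powr p < e \<longleftrightarrow> vnorm E (s m \<ominus> s n) < e powr (1 / p)" for m n
    using s p_pos \<open>0 < e\<close> by (intro powr_less_iff_less_powr_inverse) auto
  moreover have "0 < e powr (1 / p)"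
    using \<open>0 < e\<close> by simp
  ultimately show ?thesis
    using assms(1) unfolding Cauchy_seq_def by presburger
qed

lemma Cauchy_seq_closed: "Cauchy_seq E s \<Longrightarrow> s n \<in> carrier E"
  unfolding Cauchy_seq_def by blast

lemma Cauchy_seq_const: "u \<in> carrier E \<Longrightarrow> Cauchy_seq E (\<lambda>n. u)"
  unfolding Cauchy_seq_def by auto

lemma Cauchy_seq_add:
  assumes "Cauchy_seq E s" "Cauchy_seq E t"
  shows "Cauchy_seq E (\<lambda>n. s n \<oplus> t n)"
proof (rule Cauchy_seqI)
  note cl [simp] = Cauchy_seq_closed[OF assms(1)] Cauchy_seq_closed[OF assms(2)]
  show "s n \<oplus> t n \<in> carrier E" for n
    by simp
  fix e :: real assume "0 < e"
  then obtain N N' where N: "\<forall>m\<ge>N. \<forall>n\<ge>N. vnorm E (s m \<ominus> s n) powr p < e / 2"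
    and N': "\<forall>m\<ge>N'. \<forall>n\<ge>N'. vnorm E (t m \<ominus> t n) powr p < e / 2"
    using Cauchy_seqD[OF assms(1), of "e / 2"] Cauchy_seqD[OF assms(2), of "e / 2"] by auto
  have "vnorm E ((s m \<oplus> t m) \<ominus> (s n \<oplus> t n)) powr p < e"
    if "m \<ge> max N N'" "n \<ge> max N N'" for m n
  proof -
    have "vnorm E ((s m \<oplus> t m) \<ominus> (s n \<oplus> t n)) powr p
        \<le> vnorm E (s m \<ominus> s n) powr p + vnorm E (t m \<ominus> t n) powr p"
      by (simp add: add_minus_add vnorm_add_powr)
    also have "\<dots> < e / 2 + e / 2"
      using N N' that by (intro add_strict_mono) auto
    finally show ?thesis by simp
  qed
  then show "\<exists>N. \<forall>m\<ge>N. \<forall>n\<ge>N. vnorm E ((s m \<oplus> t m) \<ominus> (s n \<oplus> t n)) powr p < e"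
    by blast
qed

lemma Cauchy_seq_smult:
  assumes "Cauchy_seq E s"
  shows "Cauchy_seq E (\<lambda>n. c \<odot> s n)"
  unfolding Cauchy_seq_def
proof (intro conjI allI impI)
  note cl [simp] = Cauchy_seq_closed[OF assms]
  show "c \<odot> s n \<in> carrier E" for n
    by simp
  fix e :: real assume "0 < e"
  \<comment> \<open>Adding \<open>1\<close> keeps the denominator positive if \<open>c = 0\<close>.\<close>
  define e' where "e' = e / (norm c + 1)"
  have c: "0 < norm c + 1"
    using norm_ge_zero[of c] by linarith
  then have "0 < e'"
    using \<open>0 < e\<close> by (simp add: e'_def)
  then obtain N where N: "\<forall>m\<ge>N. \<forall>n\<ge>N. vnorm E (s m \<ominus> s n) < e'"
    using assms unfolding Cauchy_seq_def by blast
  have "vnorm E (c \<odot> s m \<ominus> c \<odot> s n) < e" if "m \<ge> N" "n \<ge> N" for m n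
  proof -
    have "vnorm E (c \<odot> s m \<ominus> c \<odot> s n) = norm c * vnorm E (s m \<ominus> s n)"
      by (simp add: smult_minus[symmetric] vnorm_smult)
    also have "\<dots> \<le> norm c * e'"
      using N that by (intro mult_left_mono) (auto simp: less_imp_le)
    also have "\<dots> < (norm c + 1) * e'"
      using \<open>0 < e'\<close> by simp
    also have "\<dots> = e"
      using c by (simp add: e'_def)
    finally show ?thesis .
  qed
  then show "\<exists>N. \<forall>m\<ge>N. \<forall>n\<ge>N. vnorm E (c \<odot> s m \<ominus> c \<odot> s n) < e"
    by blast
qed

lemma vnorm_Cauchy_convergent:
  assumes "Cauchy_seq E s"
  shows "convergent (\<lambda>n. vnorm E (s n))"
proof -
  note cl [simp] = Cauchy_seq_closed[OF assms]
  have "Cauchy (\<lambda>n. vnorm E (s n) powr p)"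
    unfolding Cauchy_def dist_real_def
  proof (intro allI impI)
    fix e :: real assume "0 < e"
    then obtain N where "\<forall>m\<ge>N. \<forall>n\<ge>N. vnorm E (s m \<ominus> s n) powr p < e"
      using Cauchy_seqD[OF assms] by blast
    then show "\<exists>N. \<forall>m\<ge>N. \<forall>n\<ge>N. \<bar>vnorm E (s m) powr p - vnorm E (s n) powr p\<bar> < e"
      using abs_vnorm_powr_diff_le[OF cl cl] by (meson le_less_trans)
  qed
  then obtain l where l: "(\<lambda>n. vnorm E (s n) powr p) \<longlonglongrightarrow> l"
    using real_Cauchy_convergent convergent_def by blast
  have "0 \<le> l"
    using l by (rule LIMSEQ_le_const) auto
  \<comment> \<open>\<open>l\<close> is the limit of the \<open>p\<close>-th powers, so the norms converge to its \<open>p\<close>-th root.\<close>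
  then have "l = (l powr (1 / p)) powr p"
    using p_pos by (simp add: powr_powr)
  with l have "(\<lambda>n. vnorm E (s n)) \<longlonglongrightarrow> l powr (1 / p)"
    using tendsto_powr_iff[of p "\<lambda>n. vnorm E (s n)" "l powr (1 / p)"] p_pos by simp
  then show ?thesis
    unfolding convergent_def by blast
qed

lemma vnorm_tendsto_cong:
  assumes "\<And>n. s n \<in> carrier E" "\<And>n. t n \<in> carrier E"
    and "(\<lambda>n. vnorm E (s n \<ominus> t n)) \<longlonglongrightarrow> 0" "(\<lambda>n. vnorm E (s n)) \<longlonglongrightarrow> l"
  shows "(\<lambda>n. vnorm E (t n)) \<longlonglongrightarrow> l"
proof -
  have "0 \<le> l"
    using assms(4) by (rule LIMSEQ_le_const) (use assms(1) in auto)
  have "(\<lambda>n. vnorm E (s n \<ominus> t n) powr p) \<longlonglongrightarrow> 0"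
    using assms by (simp add: vnorm_powr_tendsto_0_iff)
  then have "(\<lambda>n. vnorm E (s n) powr p - vnorm E (t n) powr p) \<longlonglongrightarrow> 0"
    by (rule Lim_null_comparison[rotated]) (use assms abs_vnorm_powr_diff_le in auto)
  moreover have "(\<lambda>n. vnorm E (s n) powr p) \<longlonglongrightarrow> l powr p"
    using tendsto_powr_iff[of p "\<lambda>n. vnorm E (s n)" l] p_pos assms \<open>0 \<le> l\<close> by simp
  ultimately have "(\<lambda>n. vnorm E (t n) powr p) \<longlonglongrightarrow> l powr p"
    using tendsto_diff[of "\<lambda>n. vnorm E (s n) powr p" "l powr p" sequentially
        "\<lambda>n. vnorm E (s n) powr p - vnorm E (t n) powr p" 0] by simp
  then show ?thesis
    using tendsto_powr_iff[of p "\<lambda>n. vnorm E (t n)" l] p_pos assms \<open>0 \<le> l\<close> by simp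
qed

end

section \<open>The completion\<close>

definition completion_class :: "('k, 'v) normed_module \<Rightarrow> (nat \<Rightarrow> 'v) \<Rightarrow> (nat \<Rightarrow> 'v) set" where
  "completion_class E s = null_rel E `` {s}"

lemma to_completion_eq: "to_completion E u = completion_class E (\<lambda>n. u)"
  by (simp add: to_completion_def completion_class_def)

context p_seminormed
begin

lemma equiv_null_rel: "equiv {s. Cauchy_seq E s} (null_rel E)"
proof (rule equivI)
  show "null_rel E \<subseteq> {s. Cauchy_seq E s} \<times> {s. Cauchy_seq E s}"
    by (auto simp: null_rel_def)
  show "refl_on {s. Cauchy_seq E s} (null_rel E)"
    by (auto simp: null_rel_def refl_on_def Cauchy_seq_closed)
  show "sym (null_rel E)"
    by (auto simp: null_rel_def sym_def Cauchy_seq_closed vnorm_minus_commute)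
  show "trans (null_rel E)"
  proof (rule transI)
    fix s t r assume "(s, t) \<in> null_rel E" "(t, r) \<in> null_rel E"
    then show "(s, r) \<in> null_rel E"
      using vnorm_diff_trans_tendsto_0[of s t r] by (auto simp: null_rel_def Cauchy_seq_closed)
  qed
qed

lemma completion_class_eq_iff:
  assumes "Cauchy_seq E s" "Cauchy_seq E t"
  shows "completion_class E s = completion_class E t
    \<longleftrightarrow> (\<lambda>n. vnorm E (s n \<ominus> t n)) \<longlonglongrightarrow> 0"
  using assms unfolding completion_class_def
  by (subst eq_equiv_class_iff[OF equiv_null_rel]) (auto simp: null_rel_def)

lemma carrier_completion: "carrier (completion E) = completion_class E ` {s. Cauchy_seq E s}"
  by (auto simp: completion_def quotient_def completion_class_def)

lemma completion_class_closed [intro]: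
  "Cauchy_seq E s \<Longrightarrow> completion_class E s \<in> carrier (completion E)"
  by (auto simp: carrier_completion)

lemma completion_classE:
  assumes "A \<in> carrier (completion E)"
  obtains s where "Cauchy_seq E s" "A = completion_class E s"
  using assms by (auto simp: carrier_completion)

lemma
  assumes "Cauchy_seq E s"
  shows Cauchy_seq_representative: "Cauchy_seq E (representative (completion_class E s))"
    and representative_equiv:
      "(\<lambda>n. vnorm E (s n \<ominus> representative (completion_class E s) n)) \<longlonglongrightarrow> 0"
proof -
  have "s \<in> completion_class E s"
    using assms equiv_class_self[OF equiv_null_rel] by (auto simp: completion_class_def)
  then have "representative (completion_class E s) \<in> completion_class E s"
    unfolding representative_def by (rule someI[where P = "\<lambda>t. t \<in> completion_class E s"])
  then show "Cauchy_seq E (representative (completion_class E s))"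
    "(\<lambda>n. vnorm E (s n \<ominus> representative (completion_class E s) n)) \<longlonglongrightarrow> 0"
    by (auto simp: completion_class_def null_rel_def)
qed

lemma completion_class_representative:
  assumes "Cauchy_seq E s"
  shows "completion_class E (representative (completion_class E s)) = completion_class E s"
  using representative_equiv[OF assms] Cauchy_seq_representative[OF assms]
    completion_class_eq_iff[OF assms] assms by metis

text \<open>
  The sum in \<open>completion\<close> is formed from arbitrarily chosen representatives; this congruence and the next
  one allow any other choice.
\<close>

lemma completion_class_add_cong:
  assumes "Cauchy_seq E s" "Cauchy_seq E t" "Cauchy_seq E s'" "Cauchy_seq E t'"
    and "completion_class E s = completion_class E s'"
    and "completion_class E t = completion_class E t'"
  shows "completion_class E (\<lambda>n. s n \<oplus> t n) = completion_class E (\<lambda>n. s' n \<oplus> t' n)"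
  using assms vnorm_add_tendsto_0[of "\<lambda>n. s n \<ominus> s' n" "\<lambda>n. t n \<ominus> t' n"]
  by (auto simp: completion_class_eq_iff Cauchy_seq_add Cauchy_seq_closed add_minus_add)

lemma completion_class_smult_cong:
  assumes "Cauchy_seq E s" "Cauchy_seq E s'"
    and "completion_class E s = completion_class E s'"
  shows "completion_class E (\<lambda>n. c \<odot> s n) = completion_class E (\<lambda>n. c \<odot> s' n)"
  using assms tendsto_mult_right_zero[of "\<lambda>n. vnorm E (s n \<ominus> s' n)" sequentially "norm c"]
  by (auto simp: completion_class_eq_iff Cauchy_seq_smult Cauchy_seq_closed
      smult_minus[symmetric] vnorm_smult)

lemma completion_add:
  assumes "Cauchy_seq E s" "Cauchy_seq E t"
  shows "completion_class E s \<oplus>\<^bsub>completion E\<^esub> completion_class E t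
    = completion_class E (\<lambda>n. s n \<oplus> t n)"
proof -
  have "completion_class E s \<oplus>\<^bsub>completion E\<^esub> completion_class E t
    = completion_class E (\<lambda>n. representative (completion_class E s) n
        \<oplus> representative (completion_class E t) n)"
    by (simp add: completion_def completion_class_def)
  also have "\<dots> = completion_class E (\<lambda>n. s n \<oplus> t n)"
    using assms by (intro completion_class_add_cong)
      (auto simp: Cauchy_seq_representative completion_class_representative)
  finally show ?thesis .
qed

lemma completion_smult:
  assumes "Cauchy_seq E s"
  shows "c \<odot>\<^bsub>completion E\<^esub> completion_class E s = completion_class E (\<lambda>n. c \<odot> s n)"
proof -
  have "c \<odot>\<^bsub>completion E\<^esub> completion_class E s
    = completion_class E (\<lambda>n. c \<odot> representative (completion_class E s) n)"
    by (simp add: completion_def completion_class_def)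
  also have "\<dots> = completion_class E (\<lambda>n. c \<odot> s n)"
    using assms by (intro completion_class_smult_cong)
      (auto simp: Cauchy_seq_representative completion_class_representative)
  finally show ?thesis .
qed

lemma completion_zero: "\<zero>\<^bsub>completion E\<^esub> = completion_class E (\<lambda>n. \<zero>)"
  by (simp add: completion_def completion_class_def)

lemma vnorm_completion_tendsto:
  assumes "Cauchy_seq E s"
  shows "(\<lambda>n. vnorm E (s n)) \<longlonglongrightarrow> vnorm (completion E) (completion_class E s)"
proof -
  define r where "r = representative (completion_class E s)"
  have r: "Cauchy_seq E r" "(\<lambda>n. vnorm E (s n \<ominus> r n)) \<longlonglongrightarrow> 0"
    unfolding r_def using Cauchy_seq_representative representative_equiv assms by auto
  then have "(\<lambda>n. vnorm E (r n \<ominus> s n)) \<longlonglongrightarrow> 0"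
    using assms by (simp add: vnorm_minus_commute Cauchy_seq_closed)
  moreover have "(\<lambda>n. vnorm E (r n)) \<longlonglongrightarrow> lim (\<lambda>n. vnorm E (r n))"
    using vnorm_Cauchy_convergent[OF r(1)] by (simp add: convergent_LIMSEQ_iff)
  ultimately have "(\<lambda>n. vnorm E (s n)) \<longlonglongrightarrow> lim (\<lambda>n. vnorm E (r n))"
    using vnorm_tendsto_cong[of r s] r(1) assms by (simp add: Cauchy_seq_closed)
  then show ?thesis
    by (simp add: completion_def r_def)
qed

lemma vnorm_completion_eqI:
  assumes "Cauchy_seq E s" "(\<lambda>n. vnorm E (s n)) \<longlonglongrightarrow> l"
  shows "vnorm (completion E) (completion_class E s) = l"
  using vnorm_completion_tendsto[OF assms(1)] assms(2) by (rule LIMSEQ_unique)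

lemma module_completion: "module (ring_of_type_algebra :: 'k ring) (completion E)"
proof (rule moduleI)
  note [simp] = completion_add completion_smult completion_zero Cauchy_seq_add Cauchy_seq_smult
    Cauchy_seq_const Cauchy_seq_closed
  show "cring (ring_of_type_algebra :: 'k ring)"
    by (rule cring_from_type_algebra)
  show "abelian_group (completion E)"
  proof (rule abelian_groupI)
    fix A B C
    assume A: "A \<in> carrier (completion E)"
    from A obtain s where s [simp]: "Cauchy_seq E s" "A = completion_class E s"
      by (rule completion_classE)
    show "\<zero>\<^bsub>completion E\<^esub> \<oplus>\<^bsub>completion E\<^esub> A = A"
      by simp
    have "completion_class E (\<lambda>n. (- 1) \<odot> s n) \<oplus>\<^bsub>completion E\<^esub> A = \<zero>\<^bsub>completion E\<^esub>"
      unfolding s(2) completion_add[OF Cauchy_seq_smult[OF s(1)] s(1)]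
      by (simp add: l_neg flip: minus_eq_smult)
    then show "\<exists>C\<in>carrier (completion E). C \<oplus>\<^bsub>completion E\<^esub> A = \<zero>\<^bsub>completion E\<^esub>"
      by (rule bexI) (rule completion_class_closed[OF Cauchy_seq_smult[OF s(1)]])
    assume B: "B \<in> carrier (completion E)"
    from B obtain t where t [simp]: "Cauchy_seq E t" "B = completion_class E t"
      by (rule completion_classE)
    show "A \<oplus>\<^bsub>completion E\<^esub> B \<in> carrier (completion E)"
      by (simp add: completion_class_closed)
    show "A \<oplus>\<^bsub>completion E\<^esub> B = B \<oplus>\<^bsub>completion E\<^esub> A"
      by (simp add: a_comm)
    assume C: "C \<in> carrier (completion E)"
    from C obtain r where r [simp]: "Cauchy_seq E r" "C = completion_class E r"
      by (rule completion_classE)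
    show "A \<oplus>\<^bsub>completion E\<^esub> B \<oplus>\<^bsub>completion E\<^esub> C = A \<oplus>\<^bsub>completion E\<^esub> (B \<oplus>\<^bsub>completion E\<^esub> C)"
      by (simp add: a_assoc)
  qed (simp add: completion_class_closed)
  fix a b :: 'k and A B
  assume A: "A \<in> carrier (completion E)"
  from A obtain s where s [simp]: "Cauchy_seq E s" "A = completion_class E s"
    by (rule completion_classE)
  show "a \<odot>\<^bsub>completion E\<^esub> A \<in> carrier (completion E)"
    by (simp add: completion_class_closed)
  show "(a \<oplus>\<^bsub>ring_of_type_algebra\<^esub> b) \<odot>\<^bsub>completion E\<^esub> A
    = a \<odot>\<^bsub>completion E\<^esub> A \<oplus>\<^bsub>completion E\<^esub> b \<odot>\<^bsub>completion E\<^esub> A"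
    using smult_l_distr[of a b] by simp
  show "(a \<otimes>\<^bsub>ring_of_type_algebra\<^esub> b) \<odot>\<^bsub>completion E\<^esub> A
    = a \<odot>\<^bsub>completion E\<^esub> (b \<odot>\<^bsub>completion E\<^esub> A)"
    using smult_assoc1[of a b] by simp
  show "\<one>\<^bsub>(ring_of_type_algebra :: 'k ring)\<^esub> \<odot>\<^bsub>completion E\<^esub> A = A"
    using smult_one by simp
  assume B: "B \<in> carrier (completion E)"
  from B obtain t where t [simp]: "Cauchy_seq E t" "B = completion_class E t"
    by (rule completion_classE)
  show "a \<odot>\<^bsub>completion E\<^esub> (A \<oplus>\<^bsub>completion E\<^esub> B)
    = a \<odot>\<^bsub>completion E\<^esub> A \<oplus>\<^bsub>completion E\<^esub> a \<odot>\<^bsub>completion E\<^esub> B"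
    by (simp add: smult_r_distr)
qed

lemma p_seminormed_completion: "p_seminormed p (completion E)"
proof (rule p_seminormed.intro)
  show "0 < p"
    by (rule p_pos)
  show "module (ring_of_type_algebra :: 'k ring) (completion E)"
    by (rule module_completion)
  fix A B and c :: 'k
  assume A: "A \<in> carrier (completion E)"
  from A obtain s where s [simp]: "Cauchy_seq E s" "A = completion_class E s"
    by (rule completion_classE)
  have lims: "(\<lambda>n. vnorm E (s n)) \<longlonglongrightarrow> vnorm (completion E) A"
    using vnorm_completion_tendsto by simp
  show nonneg: "0 \<le> vnorm (completion E) A"
    using lims by (rule LIMSEQ_le_const) (auto simp: Cauchy_seq_closed)
  show "vnorm (completion E) (c \<odot>\<^bsub>completion E\<^esub> A) = norm c * vnorm (completion E) A"
    unfolding s(2) completion_smult[OF s(1)]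
    using tendsto_mult_left[OF lims, of "norm c"]
    by (intro vnorm_completion_eqI) (simp_all add: Cauchy_seq_smult Cauchy_seq_closed vnorm_smult)
  assume B: "B \<in> carrier (completion E)"
  from B obtain t where t [simp]: "Cauchy_seq E t" "B = completion_class E t"
    by (rule completion_classE)
  have limt: "(\<lambda>n. vnorm E (t n)) \<longlonglongrightarrow> vnorm (completion E) B"
    using vnorm_completion_tendsto by simp
  have lim: "(\<lambda>n. vnorm E (s n \<oplus> t n)) \<longlonglongrightarrow> vnorm (completion E) (A \<oplus>\<^bsub>completion E\<^esub> B)"
    using vnorm_completion_tendsto[OF Cauchy_seq_add[OF s(1) t(1)]] by (simp add: completion_add)
  have powr: "(\<lambda>n. vnorm E (f n) powr p) \<longlonglongrightarrow> l powr p"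
    if "\<And>n. f n \<in> carrier E" "(\<lambda>n. vnorm E (f n)) \<longlonglongrightarrow> l" for f l
  proof -
    have "0 \<le> l"
      using that(2) by (rule LIMSEQ_le_const) (use that(1) in auto)
    then show ?thesis
      using that p_pos by (subst tendsto_powr_iff) auto
  qed
  show "vnorm (completion E) (A \<oplus>\<^bsub>completion E\<^esub> B) powr p
    \<le> vnorm (completion E) A powr p + vnorm (completion E) B powr p"
    by (rule LIMSEQ_le[OF powr[OF _ lim] tendsto_add[OF powr[OF _ lims] powr[OF _ limt]]])
      (auto simp: Cauchy_seq_closed intro!: vnorm_add_powr)
qed

interpretation completion: p_seminormed p "completion E"
  by (rule p_seminormed_completion)

lemma completion_minus:
  assumes "Cauchy_seq E s" "Cauchy_seq E t"
  shows "completion_class E s \<ominus>\<^bsub>completion E\<^esub> completion_class E t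
    = completion_class E (\<lambda>n. s n \<ominus> t n)"
  using assms
  by (simp add: a_minus_def completion.minus_eq_smult minus_eq_smult completion_class_closed
      completion_smult completion_add Cauchy_seq_smult Cauchy_seq_closed)

text \<open>
  Sequences of vanishing norm have been identified with zero, so the completion is separated even when
  the seminorm on \<open>E\<close> is not.
\<close>

lemma vnorm_completion_eq_0_iff:
  assumes "A \<in> carrier (completion E)"
  shows "vnorm (completion E) A = 0 \<longleftrightarrow> A = \<zero>\<^bsub>completion E\<^esub>"
proof
  assume "vnorm (completion E) A = 0"
  obtain s where s [simp]: "Cauchy_seq E s" "A = completion_class E s"
    using assms by (rule completion_classE)
  have "(\<lambda>n. vnorm E (s n)) \<longlonglongrightarrow> 0"
    using vnorm_completion_tendsto[OF s(1)] \<open>vnorm (completion E) A = 0\<close> by simp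
  then show "A = \<zero>\<^bsub>completion E\<^esub>"
    by (simp add: completion_zero completion_class_eq_iff Cauchy_seq_const Cauchy_seq_closed)
qed auto

lemma to_completion_closed [simp]:
  "u \<in> carrier E \<Longrightarrow> to_completion E u \<in> carrier (completion E)"
  by (auto simp: to_completion_eq Cauchy_seq_const)

lemma to_completion_add:
  "u \<in> carrier E \<Longrightarrow> v \<in> carrier E \<Longrightarrow>
    to_completion E (u \<oplus> v) = to_completion E u \<oplus>\<^bsub>completion E\<^esub> to_completion E v"
  by (simp add: to_completion_eq completion_add Cauchy_seq_const)

lemma to_completion_smult:
  "u \<in> carrier E \<Longrightarrow> to_completion E (c \<odot> u) = c \<odot>\<^bsub>completion E\<^esub> to_completion E u"
  by (simp add: to_completion_eq completion_smult Cauchy_seq_const)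

lemma to_completion_minus:
  "u \<in> carrier E \<Longrightarrow> v \<in> carrier E \<Longrightarrow>
    to_completion E (u \<ominus> v) = to_completion E u \<ominus>\<^bsub>completion E\<^esub> to_completion E v"
  by (simp add: to_completion_eq completion_minus Cauchy_seq_const)

lemma to_completion_zero: "to_completion E \<zero> = \<zero>\<^bsub>completion E\<^esub>"
  by (simp add: to_completion_eq completion_zero)

lemma vnorm_to_completion:
  "u \<in> carrier E \<Longrightarrow> vnorm (completion E) (to_completion E u) = vnorm E u"
  by (simp add: to_completion_eq vnorm_completion_eqI Cauchy_seq_const)

text \<open>
  The distance of \<open>s n\<close> from the class of \<open>s\<close> is the limit of \<open>\<parallel>s n - s m\<parallel>\<close> as \<open>m\<close> grows, which the Cauchy
  condition makes small for large \<open>n\<close>.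
\<close>

lemma to_completion_tendsto:
  assumes "Cauchy_seq E s"
  shows "(\<lambda>n. vnorm (completion E)
    (to_completion E (s n) \<ominus>\<^bsub>completion E\<^esub> completion_class E s)) \<longlonglongrightarrow> 0"
proof -
  note cl [simp] = Cauchy_seq_closed[OF assms]
  define x where "x n = vnorm (completion E)
    (to_completion E (s n) \<ominus>\<^bsub>completion E\<^esub> completion_class E s)" for n
  have x_nonneg: "0 \<le> x n" for n
    unfolding x_def using assms by (auto simp: completion_class_closed)
  have x: "(\<lambda>m. vnorm E (s n \<ominus> s m)) \<longlonglongrightarrow> x n" for n
  proof -
    have "Cauchy_seq E (\<lambda>m. s n \<ominus> s m)"
      using assms by (simp add: a_minus_def minus_eq_smult Cauchy_seq_add Cauchy_seq_const
          Cauchy_seq_smult)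
    then show ?thesis
      using vnorm_completion_tendsto assms
      by (simp add: x_def to_completion_eq completion_minus Cauchy_seq_const)
  qed
  have "x \<longlonglongrightarrow> 0"
  proof (rule LIMSEQ_I)
    fix e :: real assume "0 < e"
    then obtain N where N: "\<forall>m\<ge>N. \<forall>n\<ge>N. vnorm E (s m \<ominus> s n) < e / 2"
      using assms unfolding Cauchy_seq_def by (meson half_gt_zero)
    have "x n \<le> e / 2" if "n \<ge> N" for n
      using x by (rule LIMSEQ_le_const2) (use N that less_imp_le in blast)
    then show "\<exists>N. \<forall>n\<ge>N. norm (x n - 0) < e"
      using x_nonneg \<open>0 < e\<close> by (intro exI[of _ N]) force
  qed
  then show ?thesis
    by (simp add: x_def[abs_def])
qed

lemma completion_dense:
  assumes "A \<in> carrier (completion E)" "0 < e"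
  obtains u where "u \<in> carrier E" "vnorm (completion E) (to_completion E u \<ominus>\<^bsub>completion E\<^esub> A) < e"
proof -
  obtain s where s: "Cauchy_seq E s" "A = completion_class E s"
    using assms(1) by (rule completion_classE)
  have "eventually (\<lambda>n. vnorm (completion E) (to_completion E (s n) \<ominus>\<^bsub>completion E\<^esub> A) < e)
      sequentially"
    using order_tendstoD(2)[OF to_completion_tendsto[OF s(1)] \<open>0 < e\<close>] s(2) by simp
  then obtain n where "vnorm (completion E) (to_completion E (s n) \<ominus>\<^bsub>completion E\<^esub> A) < e"
    unfolding eventually_sequentially by blast
  then show thesis
    using that s Cauchy_seq_closed by blast
qed

text \<open>
  Density lets each term \<open>A k\<close> of a Cauchy sequence be replaced by an element \<open>u k\<close> of \<open>E\<close> up to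
  \<open>1 / (k + 1)\<close>; the class of the resulting Cauchy sequence in \<open>E\<close> is the limit.
\<close>

lemma complete_completion: "complete_module (completion E)"
  unfolding complete_module_def
proof (intro allI impI)
  fix A assume A: "Cauchy_seq (completion E) A"
  note cl [simp] = completion.Cauchy_seq_closed[OF A]
  let ?n = "vnorm (completion E)" and ?m = "\<lambda>u v. u \<ominus>\<^bsub>completion E\<^esub> v"
  have "\<exists>u. u \<in> carrier E \<and> ?n (?m (to_completion E u) (A k)) < 1 / (real k + 1)" for k
    by (rule completion_dense[of "A k" "1 / (real k + 1)"]) auto
  then obtain u where u: "\<And>k. u k \<in> carrier E"
    and uA: "\<And>k. ?n (?m (to_completion E (u k)) (A k)) < 1 / (real k + 1)"
    by metis
  have "(\<lambda>k. 1 / (real k + 1)) \<longlonglongrightarrow> 0"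
    using LIMSEQ_inverse_real_of_nat by (simp add: inverse_eq_divide add.commute)
  then have lim: "(\<lambda>k. ?n (?m (to_completion E (u k)) (A k))) \<longlonglongrightarrow> 0"
    by (rule Lim_null_comparison[rotated]) (use u uA in \<open>auto simp: less_imp_le\<close>)
  have "Cauchy_seq E u"
  proof (rule Cauchy_seqI)
    fix e :: real assume "0 < e"
    then have "0 < e / 3"
      by simp
    have "(\<lambda>k. ?n (?m (to_completion E (u k)) (A k)) powr p) \<longlonglongrightarrow> 0"
      using lim u by (simp add: completion.vnorm_powr_tendsto_0_iff)
    then have "eventually (\<lambda>k. ?n (?m (to_completion E (u k)) (A k)) powr p < e / 3) sequentially"
      using \<open>0 < e / 3\<close> by (rule order_tendstoD(2))
    then obtain N where N: "\<And>k. k \<ge> N \<Longrightarrow> ?n (?m (to_completion E (u k)) (A k)) powr p < e / 3"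
      unfolding eventually_sequentially by blast
    obtain N' where N': "\<And>j k. j \<ge> N' \<Longrightarrow> k \<ge> N' \<Longrightarrow> ?n (?m (A j) (A k)) powr p < e / 3"
      using completion.Cauchy_seqD[OF A \<open>0 < e / 3\<close>] by blast
    have "vnorm E (u j \<ominus> u k) powr p < e" if "j \<ge> max N N'" "k \<ge> max N N'" for j k
    proof -
      let ?uj = "to_completion E (u j)" and ?uk = "to_completion E (u k)"
      have "vnorm E (u j \<ominus> u k) powr p = ?n (?m ?uj ?uk) powr p"
        using u by (simp add: to_completion_minus[symmetric] vnorm_to_completion)
      also have "\<dots> \<le> ?n (?m ?uj (A j)) powr p + ?n (?m (A j) ?uk) powr p"
        using u by (intro completion.vnorm_diff_triangle) auto
      also have "\<dots> \<le> ?n (?m ?uj (A j)) powr p + (?n (?m (A j) (A k)) powr p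
          + ?n (?m (A k) ?uk) powr p)"
        using u by (intro add_left_mono completion.vnorm_diff_triangle) auto
      also have "\<dots> < e / 3 + (e / 3 + e / 3)"
        using N N' that u
        by (intro add_strict_mono) (auto simp: completion.vnorm_minus_commute[of "A k"])
      finally show ?thesis by simp
    qed
    then show "\<exists>N. \<forall>j\<ge>N. \<forall>k\<ge>N. vnorm E (u j \<ominus> u k) powr p < e"
      by blast
  qed (rule u)
  have "(\<lambda>k. ?n (?m (A k) (to_completion E (u k)))) \<longlonglongrightarrow> 0"
    using lim by (subst completion.vnorm_minus_commute) (use u in auto)
  then have "(\<lambda>k. ?n (?m (A k) (completion_class E u))) \<longlonglongrightarrow> 0"
    by (rule completion.vnorm_diff_trans_tendsto_0[rotated 3, OF _ to_completion_tendsto])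
      (use u \<open>Cauchy_seq E u\<close> in auto)
  then show "\<exists>B\<in>carrier (completion E). (\<lambda>k. ?n (?m (A k) B)) \<longlonglongrightarrow> 0"
    using completion_class_closed[OF \<open>Cauchy_seq E u\<close>] by blast
qed

lemma p_Banach_completion: "p_Banach_space p (completion E)"
  unfolding p_Banach_space_def
  using module_completion complete_completion
  by (auto simp: vnorm_completion_eq_0_iff completion.vnorm_smult completion.vnorm_add_powr)

end

section \<open>Extension of bounded operators to the completion\<close>

lemma p_seminormed_if_p_Banach: "0 < p \<Longrightarrow> p_Banach_space p Y \<Longrightarrow> p_seminormed p Y"
  unfolding p_Banach_space_def p_seminormed_def by blast

lemma p_Banach_limit_unique:
  assumes "0 < p" "p_Banach_space p Y"
    and "\<And>n. s n \<in> carrier Y" "u \<in> carrier Y" "v \<in> carrier Y"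
    and "(\<lambda>n. vnorm Y (s n \<ominus>\<^bsub>Y\<^esub> u)) \<longlonglongrightarrow> 0" "(\<lambda>n. vnorm Y (s n \<ominus>\<^bsub>Y\<^esub> v)) \<longlonglongrightarrow> 0"
  shows "u = v"
proof -
  interpret Y: p_seminormed p Y
    using assms by (simp add: p_seminormed_if_p_Banach)
  have "(\<lambda>n::nat. vnorm Y (u \<ominus>\<^bsub>Y\<^esub> v)) \<longlonglongrightarrow> 0"
  proof (rule Y.vnorm_diff_trans_tendsto_0[of "\<lambda>_. u" s])
    show "(\<lambda>n. vnorm Y (u \<ominus>\<^bsub>Y\<^esub> s n)) \<longlonglongrightarrow> 0"
      using assms(6) by (subst Y.vnorm_minus_commute) (use assms in auto)
  qed (use assms in auto)
  then have "vnorm Y (u \<ominus>\<^bsub>Y\<^esub> v) = 0"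
    by (simp add: LIMSEQ_const_iff)
  then have "u \<ominus>\<^bsub>Y\<^esub> v = \<zero>\<^bsub>Y\<^esub>"
    using assms unfolding p_Banach_space_def by blast
  then have "\<ominus>\<^bsub>Y\<^esub> (\<ominus>\<^bsub>Y\<^esub> v) = u"
    using assms(4,5) by (intro Y.minus_equality) (auto simp: a_minus_def)
  then show ?thesis
    using assms(5) by simp
qed

lemma bounded_operatorD:
  assumes "bounded_operator E Y T"
  shows "u \<in> carrier E \<Longrightarrow> T u \<in> carrier Y"
    and "u \<in> carrier E \<Longrightarrow> v \<in> carrier E \<Longrightarrow> T (u \<oplus>\<^bsub>E\<^esub> v) = T u \<oplus>\<^bsub>Y\<^esub> T v"
    and "u \<in> carrier E \<Longrightarrow> T (c \<odot>\<^bsub>E\<^esub> u) = c \<odot>\<^bsub>Y\<^esub> T u"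
  using assms unfolding bounded_operator_def by auto

lemma bounded_operator_minus:
  assumes "p_seminormed p E" "p_seminormed p Y" "bounded_operator E Y T"
    and "u \<in> carrier E" "v \<in> carrier E"
  shows "T (u \<ominus>\<^bsub>E\<^esub> v) = T u \<ominus>\<^bsub>Y\<^esub> T v"
proof -
  interpret E: p_seminormed p E by fact
  interpret Y: p_seminormed p Y by fact
  show ?thesis
    using assms(4,5) bounded_operatorD[OF assms(3)]
    by (simp add: a_minus_def E.minus_eq_smult Y.minus_eq_smult)
qed

lemma bounded_operator_tendsto:
  assumes "p_seminormed p E" "p_seminormed p Y" "bounded_operator E Y T"
    and "\<And>n. s n \<in> carrier E" "u \<in> carrier E" "(\<lambda>n. vnorm E (s n \<ominus>\<^bsub>E\<^esub> u)) \<longlonglongrightarrow> 0"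
  shows "(\<lambda>n. vnorm Y (T (s n) \<ominus>\<^bsub>Y\<^esub> T u)) \<longlonglongrightarrow> 0"
proof -
  interpret E: p_seminormed p E by fact
  interpret Y: p_seminormed p Y by fact
  obtain C where C: "\<And>w. w \<in> carrier E \<Longrightarrow> vnorm Y (T w) \<le> C * vnorm E w"
    using assms(3) unfolding bounded_operator_def by blast
  have "norm (vnorm Y (T (s n) \<ominus>\<^bsub>Y\<^esub> T u)) \<le> C * vnorm E (s n \<ominus>\<^bsub>E\<^esub> u)" for n
    using C[of "s n \<ominus>\<^bsub>E\<^esub> u"] bounded_operator_minus[OF assms(1-3), of "s n" u]
      assms bounded_operatorD(1)[OF assms(3)] by simp
  then show ?thesis
    by (intro Lim_null_comparison[OF always_eventually tendsto_mult_right_zero[OF assms(6)]] allI)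
qed

lemma bounded_operator_Cauchy_seq:
  assumes "p_seminormed p E" "p_seminormed p Y" "bounded_operator E Y T" "Cauchy_seq E s"
  shows "Cauchy_seq Y (\<lambda>n. T (s n))"
  unfolding Cauchy_seq_def
proof (intro conjI allI impI)
  interpret E: p_seminormed p E by fact
  interpret Y: p_seminormed p Y by fact
  note cl = E.Cauchy_seq_closed[OF assms(4)]
  show "T (s n) \<in> carrier Y" for n
    using bounded_operatorD(1)[OF assms(3)] cl by simp
  obtain C where C: "\<And>w. w \<in> carrier E \<Longrightarrow> vnorm Y (T w) \<le> C * vnorm E w"
    using assms(3) unfolding bounded_operator_def by blast
  fix e :: real assume "0 < e"
  define e' where "e' = e / (\<bar>C\<bar> + 1)"
  have "0 < e'"
    using \<open>0 < e\<close> by (simp add: e'_def add_nonneg_pos)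
  then obtain N where N: "\<forall>m\<ge>N. \<forall>n\<ge>N. vnorm E (s m \<ominus>\<^bsub>E\<^esub> s n) < e'"
    using assms(4) unfolding Cauchy_seq_def by blast
  have "vnorm Y (T (s m) \<ominus>\<^bsub>Y\<^esub> T (s n)) < e" if "m \<ge> N" "n \<ge> N" for m n
  proof -
    have "vnorm Y (T (s m) \<ominus>\<^bsub>Y\<^esub> T (s n)) = vnorm Y (T (s m \<ominus>\<^bsub>E\<^esub> s n))"
      using bounded_operator_minus[OF assms(1-3)] cl by simp
    also have "\<dots> \<le> C * vnorm E (s m \<ominus>\<^bsub>E\<^esub> s n)"
      using C cl by simp
    also have "\<dots> \<le> \<bar>C\<bar> * e'"
      using N that cl by (intro mult_mono) (auto simp: less_imp_le)
    also have "\<dots> < (\<bar>C\<bar> + 1) * e'"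
      using \<open>0 < e'\<close> by simp
    also have "\<dots> = e"
      by (simp add: e'_def)
    finally show ?thesis .
  qed
  then show "\<exists>N. \<forall>m\<ge>N. \<forall>n\<ge>N. vnorm Y (T (s m) \<ominus>\<^bsub>Y\<^esub> T (s n)) < e"
    by blast
qed

context p_seminormed
begin

interpretation completion: p_seminormed p "completion E"
  by (rule p_seminormed_completion)

text \<open>
  Two bounded operators that agree on the dense image of \<open>E\<close> have the same limits along any sequence
  representing \<open>A\<close>.
\<close>

lemma bounded_operator_completion_eqI:
  assumes Y: "p_Banach_space p Y"
    and S: "bounded_operator (completion E) Y S" and S': "bounded_operator (completion E) Y S'"
    and eq: "\<And>u. u \<in> carrier E \<Longrightarrow> S (to_completion E u) = S' (to_completion E u)"
    and A: "A \<in> carrier (completion E)"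
  shows "S A = S' A"
proof -
  note Y' = p_seminormed_if_p_Banach[OF p_pos Y]
  obtain s where s: "Cauchy_seq E s" "A = completion_class E s"
    using A by (rule completion_classE)
  have "(\<lambda>n. vnorm (completion E) (to_completion E (s n) \<ominus>\<^bsub>completion E\<^esub> A)) \<longlonglongrightarrow> 0"
    using to_completion_tendsto s by simp
  note * = bounded_operator_tendsto[OF p_seminormed_completion Y' _ _ A this]
  have "(\<lambda>n. vnorm Y (S (to_completion E (s n)) \<ominus>\<^bsub>Y\<^esub> S A)) \<longlonglongrightarrow> 0"
    using S s by (intro *) (auto simp: Cauchy_seq_closed)
  moreover have "(\<lambda>n. vnorm Y (S (to_completion E (s n)) \<ominus>\<^bsub>Y\<^esub> S' A)) \<longlonglongrightarrow> 0"
    using *[OF S'] s eq by (simp add: Cauchy_seq_closed)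
  ultimately show ?thesis
    using bounded_operatorD(1)[OF S] bounded_operatorD(1)[OF S'] s A
    by (intro p_Banach_limit_unique[OF p_pos Y, of "\<lambda>n. S (to_completion E (s n))"])
      (auto simp: Cauchy_seq_closed)
qed

text \<open>
  A bounded operator sends Cauchy sequences to Cauchy sequences, and the extension maps the class of
  \<open>s\<close> to the limit of \<open>T (s n)\<close>. The bound on \<open>T\<close> passes to the limit, so the extension keeps the constant
  \<open>C\<close>.
\<close>

lemma bounded_operator_extension:
  assumes Y: "p_Banach_space p Y" and T: "bounded_operator E Y T"
    and C: "\<And>u. u \<in> carrier E \<Longrightarrow> vnorm Y (T u) \<le> C * vnorm E u"
  obtains S where "bounded_operator (completion E) Y S"
    "\<And>u. u \<in> carrier E \<Longrightarrow> S (to_completion E u) = T u"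
    "\<And>A. A \<in> carrier (completion E) \<Longrightarrow> vnorm Y (S A) \<le> C * vnorm (completion E) A"
proof -
  interpret Y: p_seminormed p Y
    using p_pos Y by (rule p_seminormed_if_p_Banach)
  note [simp] = Cauchy_seq_closed
  have E': "p_seminormed p E" and Y': "p_seminormed p Y"
    by unfold_locales
  note Tcl [simp] = bounded_operatorD(1)[OF T]
  define lim_of where "lim_of s y \<longleftrightarrow> y \<in> carrier Y \<and> (\<lambda>n. vnorm Y (T (s n) \<ominus>\<^bsub>Y\<^esub> y)) \<longlonglongrightarrow> 0"
    for s y
  define S where "S A = (SOME y. lim_of (representative A) y)" for A
  have lim_of_ex: "\<exists>y. lim_of s y" if "Cauchy_seq E s" for s
    using Y bounded_operator_Cauchy_seq[OF E' Y' T that]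
    unfolding p_Banach_space_def complete_module_def lim_of_def by blast
  have lim_of_unique: "y = z" if "Cauchy_seq E s" "lim_of s y" "lim_of s z" for s y z
    using that p_Banach_limit_unique[OF p_pos Y, of "\<lambda>n. T (s n)" y z] by (simp add: lim_of_def)
  have lim_of_S: "lim_of s (S (completion_class E s))" if s: "Cauchy_seq E s" for s
  proof -
    define r where "r = representative (completion_class E s)"
    have r: "Cauchy_seq E r" "(\<lambda>n. vnorm E (s n \<ominus> r n)) \<longlonglongrightarrow> 0"
      unfolding r_def using Cauchy_seq_representative representative_equiv s by auto
    have "lim_of r (S (completion_class E s))"
      unfolding S_def r_def[symmetric] using lim_of_ex[OF r(1)] by (rule someI_ex)
    moreover have "(\<lambda>n. vnorm Y (T (s n) \<ominus>\<^bsub>Y\<^esub> T (r n))) \<longlonglongrightarrow> 0"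
      using bounded_operator_tendsto[OF E' Y' T, of "\<lambda>n. s n \<ominus> r n" "\<zero>"] r s
        bounded_operatorD(3)[OF T, of "\<zero>" 0] smult_l_null[of "\<zero>"]
        Y.smult_l_null[of "T \<zero>"]
      by (simp add: bounded_operator_minus[OF E' Y' T])
    ultimately show ?thesis
      using Y.vnorm_diff_trans_tendsto_0[of "\<lambda>n. T (s n)" "\<lambda>n. T (r n)"
          "\<lambda>n. S (completion_class E s)"] s r(1)
      by (simp add: lim_of_def)
  qed
  have S_eqI: "S (completion_class E s) = y" if "Cauchy_seq E s" "lim_of s y" for s y
    using lim_of_unique[OF that(1) lim_of_S[OF that(1)] that(2)] .
  have S_cl: "S A \<in> carrier Y" if "A \<in> carrier (completion E)" for A
    using that lim_of_S by (auto simp: lim_of_def elim!: completion_classE)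
  have S_T: "S (to_completion E u) = T u" if "u \<in> carrier E" for u
    using that unfolding to_completion_eq
    by (intro S_eqI) (auto simp: lim_of_def Cauchy_seq_const)
  have S_bound: "vnorm Y (S A) \<le> C * vnorm (completion E) A"
    if A: "A \<in> carrier (completion E)" for A
  proof -
    obtain s where s: "Cauchy_seq E s" "A = completion_class E s"
      using A by (rule completion_classE)
    have "(\<lambda>n. vnorm Y (\<ominus>\<^bsub>Y\<^esub> (T (s n) \<ominus>\<^bsub>Y\<^esub> S A))) \<longlonglongrightarrow> 0"
      using lim_of_S[OF s(1)] s by (simp add: lim_of_def)
    then have "(\<lambda>n. vnorm Y (S A \<ominus>\<^bsub>Y\<^esub> T (s n))) \<longlonglongrightarrow> 0"
      using that s by (simp add: Y.minus_swap[symmetric] S_cl)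
    then have "(\<lambda>n. vnorm Y (T (s n))) \<longlonglongrightarrow> vnorm Y (S A)"
      by (rule Y.vnorm_tendsto_cong[rotated 2]) (use s that S_cl in auto)
    moreover have "(\<lambda>n. C * vnorm E (s n)) \<longlonglongrightarrow> C * vnorm (completion E) A"
      using vnorm_completion_tendsto[OF s(1)] s(2) by (intro tendsto_mult_left) simp
    ultimately show ?thesis
      by (rule LIMSEQ_le) (use C s in auto)
  qed
  have "bounded_operator (completion E) Y S"
    unfolding bounded_operator_def
  proof (intro conjI ballI allI)
    show "S \<in> carrier (completion E) \<rightarrow> carrier Y"
      using S_cl by auto
    show "\<exists>C. \<forall>A\<in>carrier (completion E). vnorm Y (S A) \<le> C * vnorm (completion E) A"
      using S_bound by blast
    fix A assume A: "A \<in> carrier (completion E)"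
    then obtain s where s: "Cauchy_seq E s" "A = completion_class E s"
      by (rule completion_classE)
    note ls = lim_of_S[OF s(1)]
    show "S (c \<odot>\<^bsub>completion E\<^esub> A) = c \<odot>\<^bsub>Y\<^esub> S A" for c
    proof -
      have "(\<lambda>n. norm c * vnorm Y (T (s n) \<ominus>\<^bsub>Y\<^esub> S A)) \<longlonglongrightarrow> 0"
        using ls s by (intro tendsto_mult_right_zero) (simp add: lim_of_def)
      then have "lim_of (\<lambda>n. c \<odot> s n) (c \<odot>\<^bsub>Y\<^esub> S A)"
        using s S_cl[OF A]
        by (simp add: lim_of_def bounded_operatorD(3)[OF T] Y.smult_minus[symmetric] Y.vnorm_smult)
      then show ?thesis
        using s by (simp add: completion_smult S_eqI Cauchy_seq_smult)
    qed
    fix B assume B: "B \<in> carrier (completion E)"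
    then obtain t where t: "Cauchy_seq E t" "B = completion_class E t"
      by (rule completion_classE)
    have "(\<lambda>n. vnorm Y ((T (s n) \<ominus>\<^bsub>Y\<^esub> S A) \<oplus>\<^bsub>Y\<^esub> (T (t n) \<ominus>\<^bsub>Y\<^esub> S B))) \<longlonglongrightarrow> 0"
      using ls lim_of_S[OF t(1)] s t S_cl[OF A] S_cl[OF B]
      by (intro Y.vnorm_add_tendsto_0) (auto simp: lim_of_def)
    then have "lim_of (\<lambda>n. s n \<oplus> t n) (S A \<oplus>\<^bsub>Y\<^esub> S B)"
      using s t S_cl[OF A] S_cl[OF B]
      by (simp add: lim_of_def bounded_operatorD(2)[OF T] Y.add_minus_add)
    then show "S (A \<oplus>\<^bsub>completion E\<^esub> B) = S A \<oplus>\<^bsub>Y\<^esub> S B"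
      using s t by (simp add: completion_add S_eqI Cauchy_seq_add)
  qed
  then show thesis
    using that S_T S_bound by blast
qed

end

section \<open>Finitely supported functions and linear combinations\<close>

text \<open>
  The candidate \<open>N\<close> for the norm is a parameter, since the free norm will be compared with other
  seminorms on the same space of functions.
\<close>

definition finite_functions ::
    "'m set \<Rightarrow> (('m \<Rightarrow> 'k) \<Rightarrow> real) \<Rightarrow> ('k::real_normed_field, 'm \<Rightarrow> 'k) normed_module" where
  "finite_functions S N = \<lparr>
     carrier = {a. finite {x. a x \<noteq> 0} \<and> {x. a x \<noteq> 0} \<subseteq> S},
     mult = undefined,
     one = undefined,
     zero = (\<lambda>x. 0),
     add = (\<lambda>a a' x. a x + a' x),
     smult = (\<lambda>c a x. c * a x),
     vnorm = N \<rparr>"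

lemma finite_free_space_eq: "finite_free_space p M d b = finite_functions (M - {b}) (free_norm p M d b)"
  by (simp add: finite_free_space_def finite_functions_def)

lemma finite_functions_simps [simp]:
  "carrier (finite_functions S N) = {a. finite {x. a x \<noteq> 0} \<and> {x. a x \<noteq> 0} \<subseteq> S}"
  "\<zero>\<^bsub>finite_functions S N\<^esub> = (\<lambda>x. 0)"
  "a \<oplus>\<^bsub>finite_functions S N\<^esub> a' = (\<lambda>x. a x + a' x)"
  "c \<odot>\<^bsub>finite_functions S N\<^esub> a = (\<lambda>x. c * a x)"
  "vnorm (finite_functions S N) a = N a"
  by (simp_all add: finite_functions_def)

lemma finite_support_add:
  fixes a a' :: "'m \<Rightarrow> 'k::real_normed_field"
  assumes "finite {x. a x \<noteq> 0}" "finite {x. a' x \<noteq> 0}"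
  shows "finite {x. a x + a' x \<noteq> 0}"
  by (rule finite_subset[OF _ finite_UnI[OF assms]]) auto

lemma support_add_subset:
  fixes a a' :: "'m \<Rightarrow> 'k::real_normed_field"
  assumes "{x. a x \<noteq> 0} \<subseteq> S" "{x. a' x \<noteq> 0} \<subseteq> S"
  shows "{x. a x + a' x \<noteq> 0} \<subseteq> S"
proof
  fix x assume "x \<in> {x. a x + a' x \<noteq> 0}"
  then have "a x \<noteq> 0 \<or> a' x \<noteq> 0"
    by auto
  then show "x \<in> S"
    using assms by blast
qed

lemma module_finite_functions:
  "module (ring_of_type_algebra :: 'k::real_normed_field ring) (finite_functions S N)"
proof (rule moduleI)
  show "cring (ring_of_type_algebra :: 'k ring)"
    by (rule cring_from_type_algebra)
  show "abelian_group (finite_functions S N :: ('k, _) normed_module)"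
  proof (rule abelian_groupI)
    fix a assume "a \<in> carrier (finite_functions S N :: ('k, _) normed_module)"
    then show "\<exists>a'\<in>carrier (finite_functions S N). a' \<oplus>\<^bsub>finite_functions S N\<^esub> a
      = \<zero>\<^bsub>finite_functions S N\<^esub>"
      by (intro bexI[of _ "\<lambda>x. - a x"]) auto
  qed (simp_all add: finite_support_add support_add_subset add_ac)
qed (auto simp: finite_support_add algebra_simps dest: support_add_subset)

text \<open>
  The linear extension to finitely supported functions of a map \<open>g\<close> defined on points.
\<close>

definition lincomb :: "('k::real_normed_field, 'v) normed_module \<Rightarrow> ('m \<Rightarrow> 'v) \<Rightarrow> ('m \<Rightarrow> 'k) \<Rightarrow> 'v" where
  "lincomb Y g a = (\<Oplus>\<^bsub>Y\<^esub>x\<in>{x. a x \<noteq> 0}. a x \<odot>\<^bsub>Y\<^esub> g x)"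

text \<open>
  The point \<open>b\<close> gets the zero function, so that \<open>x \<mapsto> point_mass b x\<close> vanishes at the distinguished point.
\<close>

definition point_mass :: "'m \<Rightarrow> 'm \<Rightarrow> 'm \<Rightarrow> 'k::real_normed_field" where
  "point_mass b x = (if x = b then (\<lambda>y. 0) else (\<lambda>y. if y = x then 1 else 0))"

lemma delta_eq: "delta p M d b x = to_completion (finite_free_space p M d b) (point_mass b x)"
  by (simp add: delta_def point_mass_def)

lemma point_mass_base [simp]: "point_mass b b = (\<lambda>y. 0)"
  by (simp add: point_mass_def)

lemma support_point_mass:
  "{y. (point_mass b x y :: 'k::real_normed_field) \<noteq> 0} = (if x = b then {} else {x})"
  by (auto simp: point_mass_def)

lemma point_mass_closed [simp]:
  "x \<in> M \<Longrightarrow> point_mass b x \<in> carrier (finite_functions (M - {b}) N)"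
  by (simp add: support_point_mass)

context p_seminormed
begin

lemma smult_carrier [simp]: "u \<in> carrier E \<Longrightarrow> c \<odot> u \<in> carrier E"
  by simp

lemma lincomb_eq_finsum:
  assumes "finite T" "{x. a x \<noteq> 0} \<subseteq> T" "g \<in> T \<rightarrow> carrier E"
  shows "lincomb E g a = (\<Oplus>x\<in>T. a x \<odot> g x)"
  unfolding lincomb_def
  using assms smult_l_null
  by (intro add.finprod_mono_neutral_cong_left) (auto simp: Pi_iff)

lemma lincomb_closed:
  assumes "g \<in> S \<rightarrow> carrier E" "{x. a x \<noteq> 0} \<subseteq> S"
  shows "lincomb E g a \<in> carrier E"
proof -
  have "g x \<in> carrier E" if "a x \<noteq> 0" for x
    using assms that by blast
  then show ?thesis
    unfolding lincomb_def by (intro finsum_closed) auto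
qed

lemma lincomb_add:
  assumes g: "g \<in> S \<rightarrow> carrier E"
    and "finite {x. a x \<noteq> 0}" "{x. a x \<noteq> 0} \<subseteq> S" "finite {x. a' x \<noteq> 0}" "{x. a' x \<noteq> 0} \<subseteq> S"
  shows "lincomb E g (\<lambda>x. a x + a' x) = lincomb E g a \<oplus> lincomb E g a'"
proof -
  define T where "T = {x. a x \<noteq> 0} \<union> {x. a' x \<noteq> 0}"
  have T: "finite T" "g \<in> T \<rightarrow> carrier E"
    using assms by (auto simp: T_def)
  have "lincomb E g (\<lambda>x. a x + a' x) = (\<Oplus>x\<in>T. (a x + a' x) \<odot> g x)"
    using T by (intro lincomb_eq_finsum) (auto simp: T_def)
  also have "\<dots> = (\<Oplus>x\<in>T. a x \<odot> g x \<oplus> a' x \<odot> g x)"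
    using T smult_l_distr by (intro add.finprod_cong') (auto simp: Pi_iff)
  also have "\<dots> = (\<Oplus>x\<in>T. a x \<odot> g x) \<oplus> (\<Oplus>x\<in>T. a' x \<odot> g x)"
    using T by (intro finsum_addf) (auto simp: Pi_iff)
  also have "(\<Oplus>x\<in>T. a x \<odot> g x) = lincomb E g a"
    using T by (intro lincomb_eq_finsum[symmetric]) (auto simp: T_def)
  also have "(\<Oplus>x\<in>T. a' x \<odot> g x) = lincomb E g a'"
    using T by (intro lincomb_eq_finsum[symmetric]) (auto simp: T_def)
  finally show ?thesis .
qed

lemma lincomb_smult:
  assumes g: "g \<in> S \<rightarrow> carrier E" and "finite {x. a x \<noteq> 0}" "{x. a x \<noteq> 0} \<subseteq> S"
  shows "lincomb E g (\<lambda>x. c * a x) = c \<odot> lincomb E g a"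
proof -
  have g': "g \<in> {x. a x \<noteq> 0} \<rightarrow> carrier E"
    using assms by auto
  have "lincomb E g (\<lambda>x. c * a x) = (\<Oplus>x\<in>{x. a x \<noteq> 0}. (c * a x) \<odot> g x)"
    using assms g' by (intro lincomb_eq_finsum) auto
  also have "\<dots> = (\<Oplus>x\<in>{x. a x \<noteq> 0}. c \<odot> (a x \<odot> g x))"
    using g' smult_assoc1 by (intro add.finprod_cong') (auto simp: Pi_iff)
  also have "\<dots> = c \<odot> lincomb E g a"
    unfolding lincomb_def using assms g'
    by (intro finsum_smult_ldistr[symmetric]) (auto simp: Pi_iff)
  finally show ?thesis .
qed

lemma lincomb_point_mass:
  assumes "g x \<in> carrier E" "g b = \<zero>"
  shows "lincomb E g (point_mass b x) = g x"
proof (cases "x = b")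
  case True
  then show ?thesis
    using assms by (simp add: lincomb_def)
next
  case False
  then have "lincomb E g (point_mass b x) = (\<Oplus>y\<in>{x}. point_mass b x y \<odot> g y)"
    unfolding lincomb_def support_point_mass by simp
  also have "\<dots> = g x"
    using assms False smult_one by (simp add: point_mass_def)
  finally show ?thesis .
qed

lemma vnorm_lincomb_powr_le:
  assumes "finite {x. a x \<noteq> 0}" "g \<in> {x. a x \<noteq> 0} \<rightarrow> carrier E"
  shows "vnorm E (lincomb E g a) powr p \<le> (\<Sum>x | a x \<noteq> 0. (norm (a x) * vnorm E (g x)) powr p)"
proof -
  have "vnorm E (\<Oplus>x\<in>T. a x \<odot> g x) powr p \<le> (\<Sum>x\<in>T. (norm (a x) * vnorm E (g x)) powr p)"
    if "finite T" "g \<in> T \<rightarrow> carrier E" for T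
    using that
  proof (induction T rule: finite_induct)
    case (insert x T)
    then have "vnorm E (\<Oplus>x\<in>insert x T. a x \<odot> g x) powr p
      \<le> vnorm E (a x \<odot> g x) powr p + vnorm E (\<Oplus>x\<in>T. a x \<odot> g x) powr p"
      by (subst finsum_insert) (auto simp: Pi_iff intro!: vnorm_add_powr finsum_closed)
    also have "\<dots> \<le> (norm (a x) * vnorm E (g x)) powr p
        + (\<Sum>x\<in>T. (norm (a x) * vnorm E (g x)) powr p)"
      using insert by (intro add_mono) (auto simp: vnorm_smult)
    finally show ?case
      using insert by simp
  qed (use p_pos in simp)
  then show ?thesis
    unfolding lincomb_def using assms by blast
qed

end

text \<open>
  The point masses span the finitely supported functions; the induction removes one point of the
  support at a time.
\<close>

lemma linear_eq_on_finite_functions: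
  fixes T T' :: "('m \<Rightarrow> 'k::real_normed_field) \<Rightarrow> 'v" and N :: "('m \<Rightarrow> 'k) \<Rightarrow> real"
    and M :: "'m set" and b :: 'm
  defines "F \<equiv> finite_functions (M - {b}) N"
  assumes "p_seminormed p Y"
    and T: "T \<in> carrier F \<rightarrow> carrier Y" "T' \<in> carrier F \<rightarrow> carrier Y"
    and add: "\<And>u v. u \<in> carrier F \<Longrightarrow> v \<in> carrier F \<Longrightarrow> T (u \<oplus>\<^bsub>F\<^esub> v) = T u \<oplus>\<^bsub>Y\<^esub> T v"
      "\<And>u v. u \<in> carrier F \<Longrightarrow> v \<in> carrier F \<Longrightarrow> T' (u \<oplus>\<^bsub>F\<^esub> v) = T' u \<oplus>\<^bsub>Y\<^esub> T' v"
    and smult: "\<And>c u. u \<in> carrier F \<Longrightarrow> T (c \<odot>\<^bsub>F\<^esub> u) = c \<odot>\<^bsub>Y\<^esub> T u"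
      "\<And>c u. u \<in> carrier F \<Longrightarrow> T' (c \<odot>\<^bsub>F\<^esub> u) = c \<odot>\<^bsub>Y\<^esub> T' u"
    and eq: "\<And>x. x \<in> M - {b} \<Longrightarrow> T (point_mass b x) = T' (point_mass b x)"
    and a: "a \<in> carrier F"
  shows "T a = T' a"
proof -
  interpret Y: p_seminormed p Y by fact
  have "T a = T' a" if "finite A" "{x. a x \<noteq> 0} = A" "A \<subseteq> M - {b}" for A a
    using that
  proof (induction A arbitrary: a rule: finite_induct)
    case empty
    then have "a = (\<lambda>x. 0)"
      by auto
    then have "a \<in> carrier F" "0 \<odot>\<^bsub>F\<^esub> a = a"
      by (simp_all add: F_def)
    then show ?case
      using smult[of a 0] T[THEN funcset_mem, of a]
        Y.smult_l_null[of "T a"] Y.smult_l_null[of "T' a"] by simp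
  next
    case (insert x A)
    define a' where "a' = (\<lambda>y. if y = x then 0 else a y)"
    have supp: "{y. a' y \<noteq> 0} = A"
      using insert by (auto simp: a'_def)
    have x: "x \<in> M - {b}"
      using insert by auto
    have pm: "point_mass b x \<in> carrier F"
      using x unfolding F_def by (intro point_mass_closed) auto
    have "a' \<in> carrier F"
      using supp insert unfolding F_def by simp
    moreover have "a x \<odot>\<^bsub>F\<^esub> point_mass b x \<in> carrier F"
      using pm unfolding F_def by auto
    ultimately have cl: "a' \<in> carrier F" "point_mass b x \<in> carrier F"
      "a x \<odot>\<^bsub>F\<^esub> point_mass b x \<in> carrier F"
      using pm by blast+
    have "a = a' \<oplus>\<^bsub>F\<^esub> (a x \<odot>\<^bsub>F\<^esub> point_mass b x)"
      using x by (auto simp: F_def a'_def point_mass_def)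
    moreover have "T a' = T' a'"
      using insert supp by auto
    ultimately show ?case
      using add cl smult eq[OF x] by metis
  qed
  then show ?thesis
    using a by (auto simp: F_def)
qed

section \<open>The free norm is the largest admissible p-seminorm\<close>

definition based_contraction ::
    "'m set \<Rightarrow> ('m \<Rightarrow> 'm \<Rightarrow> real) \<Rightarrow> 'm \<Rightarrow> ('k::real_normed_field, 'v) normed_module \<Rightarrow> ('m \<Rightarrow> 'v) \<Rightarrow> bool"
  where
  "based_contraction M d b Y g \<longleftrightarrow> g \<in> M \<rightarrow> carrier Y \<and> g b = \<zero>\<^bsub>Y\<^esub> \<and>
     (\<forall>x\<in>M. \<forall>y\<in>M. vnorm Y (g x \<ominus>\<^bsub>Y\<^esub> g y) \<le> d x y)"

lemma free_norm_eq_Sup_lincomb: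
  "free_norm p M d b (a :: 'm \<Rightarrow> 'k::real_normed_field) =
     Sup {vnorm E (lincomb E f a) | (E :: ('k, (nat \<Rightarrow> 'm \<Rightarrow> 'k) set) normed_module) f.
       p_Banach_space p E \<and> based_contraction M d b E f}"
  unfolding free_norm_def lincomb_def based_contraction_def by simp

locale pointed_metric_exponent = Metric_space M d for M :: "'m set" and d +
  fixes b :: 'm and p :: real
  assumes base_in: "b \<in> M" and exponent_pos: "0 < p"
begin

text \<open>
  Since \<open>\<parallel>g x\<parallel> = \<parallel>g x - g b\<parallel> \<le> d x b\<close>, the norm of a linear combination is bounded independently of \<open>Y\<close>
  and \<open>g\<close>. Hence the supremum defining the free norm is finite.
\<close>

lemma vnorm_lincomb_le:
  assumes "p_seminormed p Y" "based_contraction M d b Y g"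
    and "a \<in> carrier (finite_functions (M - {b}) N)"
  shows "vnorm Y (lincomb Y g a) \<le> (\<Sum>x | a x \<noteq> 0. (norm (a x) * d x b) powr p) powr (1 / p)"
proof -
  interpret Y: p_seminormed p Y by fact
  have g: "g \<in> M \<rightarrow> carrier Y" "g b = \<zero>\<^bsub>Y\<^esub>"
    "\<And>x y. x \<in> M \<Longrightarrow> y \<in> M \<Longrightarrow> vnorm Y (g x \<ominus>\<^bsub>Y\<^esub> g y) \<le> d x y"
    using assms(2) by (auto simp: based_contraction_def)
  have supp: "finite {x. a x \<noteq> 0}" "\<And>x. a x \<noteq> 0 \<Longrightarrow> x \<in> M"
    using assms(3) by auto
  have gx: "g x \<in> carrier Y" "vnorm Y (g x) \<le> d x b" if "x \<in> M" for x
  proof -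
    show "g x \<in> carrier Y"
      using g(1) that by auto
    then show "vnorm Y (g x) \<le> d x b"
      using g(3)[OF that base_in] g(2) by simp
  qed
  have "vnorm Y (lincomb Y g a) powr p \<le> (\<Sum>x | a x \<noteq> 0. (norm (a x) * vnorm Y (g x)) powr p)"
    using supp gx by (intro Y.vnorm_lincomb_powr_le) auto
  also have "\<dots> \<le> (\<Sum>x | a x \<noteq> 0. (norm (a x) * d x b) powr p)"
    using supp gx exponent_pos
    by (intro sum_mono powr_mono2 mult_left_mono mult_nonneg_nonneg) auto
  also have "\<dots> = ((\<Sum>x | a x \<noteq> 0. (norm (a x) * d x b) powr p) powr (1 / p)) powr p"
    using exponent_pos by (simp add: powr_powr sum_nonneg)
  finally show ?thesis
    using exponent_pos Y.lincomb_closed[of g M a] g(1) supp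
    by (subst (asm) powr_le_iff_le) (auto intro: Y.vnorm_nonneg)
qed

lemma free_norm_set_bdd_above:
  assumes "(a :: 'm \<Rightarrow> 'k::real_normed_field) \<in> carrier (finite_functions (M - {b}) N)"
  shows "bdd_above {vnorm E (lincomb E f a) |
    (E :: ('k, (nat \<Rightarrow> 'm \<Rightarrow> 'k) set) normed_module) f.
       p_Banach_space p E \<and> based_contraction M d b E f}"
  using vnorm_lincomb_le[OF p_seminormed_if_p_Banach[OF exponent_pos] _ assms]
  by (intro bdd_aboveI) blast

text \<open>
  The witness is the completion of the finitely supported functions with respect to \<open>N\<close>, with
  \<open>f x\<close> the class of the point mass at \<open>x\<close>. Its vectors have the type over which the supremum in \<open>free_norm\<close> ranges.
\<close>

lemma p_Banach_realization:
  fixes N :: "('m \<Rightarrow> 'k::real_normed_field) \<Rightarrow> real"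
  assumes "p_seminormed p (finite_functions (M - {b}) N)"
    and N: "\<And>x y. x \<in> M \<Longrightarrow> y \<in> M \<Longrightarrow>
      N (point_mass b x \<ominus>\<^bsub>finite_functions (M - {b}) N\<^esub> point_mass b y) \<le> d x y"
  shows "\<exists>(E :: ('k, (nat \<Rightarrow> 'm \<Rightarrow> 'k) set) normed_module) f.
    p_Banach_space p E \<and> based_contraction M d b E f \<and>
    (\<forall>a\<in>carrier (finite_functions (M - {b}) N). vnorm E (lincomb E f a) = N a)"
proof -
  define F where "F = finite_functions (M - {b}) N"
  interpret F: p_seminormed p F
    unfolding F_def by fact
  interpret E: p_seminormed p "completion F"
    by (rule F.p_seminormed_completion)
  define f where "f x = to_completion F (point_mass b x)" for x
  have pm: "point_mass b x \<in> carrier F" if "x \<in> M" for x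
    unfolding F_def using that by (rule point_mass_closed)
  have "\<zero>\<^bsub>F\<^esub> = (\<lambda>x. 0)"
    by (simp add: F_def)
  then have f: "f \<in> M \<rightarrow> carrier (completion F)" "f b = \<zero>\<^bsub>completion F\<^esub>"
    using pm F.to_completion_zero by (auto simp: f_def simp del: finite_functions_simps(1))
  have "based_contraction M d b (completion F) f"
    unfolding based_contraction_def
  proof (intro conjI ballI f)
    fix x y assume "x \<in> M" "y \<in> M"
    then show "vnorm (completion F) (f x \<ominus>\<^bsub>completion F\<^esub> f y) \<le> d x y"
      using pm N unfolding f_def
      by (simp add: F.to_completion_minus[symmetric] F.vnorm_to_completion) (simp add: F_def)
  qed
  moreover have "vnorm (completion F) (lincomb (completion F) f a) = N a" if "a \<in> carrier F" for a
  proof -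
    have f': "f \<in> M - {b} \<rightarrow> carrier (completion F)"
      using f(1) by auto
    have "lincomb (completion F) f a = to_completion F a"
    proof (rule linear_eq_on_finite_functions[where M = M and b = b and N = N, folded F_def,
          OF E.p_seminormed_axioms _ _ _ _ _ _ _ that])
      fix u v and c :: 'k
      assume u: "u \<in> carrier F"
      show "lincomb (completion F) f (c \<odot>\<^bsub>F\<^esub> u) = c \<odot>\<^bsub>completion F\<^esub> lincomb (completion F) f u"
        using u E.lincomb_smult[OF f'] by (simp add: F_def)
      show "to_completion F (c \<odot>\<^bsub>F\<^esub> u) = c \<odot>\<^bsub>completion F\<^esub> to_completion F u"
        using u by (rule F.to_completion_smult)
      assume v: "v \<in> carrier F"
      show "lincomb (completion F) f (u \<oplus>\<^bsub>F\<^esub> v)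
        = lincomb (completion F) f u \<oplus>\<^bsub>completion F\<^esub> lincomb (completion F) f v"
        using u v E.lincomb_add[OF f'] by (simp add: F_def)
      show "to_completion F (u \<oplus>\<^bsub>F\<^esub> v) = to_completion F u \<oplus>\<^bsub>completion F\<^esub> to_completion F v"
        using u v by (rule F.to_completion_add)
    next
      show "lincomb (completion F) f \<in> carrier F \<rightarrow> carrier (completion F)"
        using E.lincomb_closed[OF f'] by (auto simp: F_def)
      show "to_completion F \<in> carrier F \<rightarrow> carrier (completion F)"
        by simp
      show "lincomb (completion F) f (point_mass b x) = to_completion F (point_mass b x)"
        if "x \<in> M - {b}" for x
        using that f E.lincomb_point_mass[of f x b] by (auto simp: f_def Pi_iff)
    qed
    then show ?thesis
      using that by (simp add: F.vnorm_to_completion) (simp add: F_def)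
  qed
  ultimately show ?thesis
    using F.p_Banach_completion unfolding F_def by blast
qed


text \<open>
  The free norm dominates the seminorm \<open>a \<mapsto> \<parallel>lincomb Y g a\<parallel>\<close>, whatever the type of the vectors of \<open>Y\<close>:
  \<open>p_Banach_realization\<close> turns this seminorm into
  the norm of an admissible \<open>p\<close>-Banach space.
\<close>

lemma vnorm_lincomb_le_free_norm:
  fixes Y :: "('k::real_normed_field, 'v) normed_module"
  assumes Y: "p_seminormed p Y" and g: "based_contraction M d b Y g"
    and a: "a \<in> carrier (finite_functions (M - {b}) N')"
  shows "vnorm Y (lincomb Y g a) \<le> free_norm p M d b a"
proof -
  interpret Y: p_seminormed p Y by fact
  define N where "N = (\<lambda>a. vnorm Y (lincomb Y g a))"
  define F where "F = finite_functions (M - {b}) N"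
  have gM: "g \<in> M \<rightarrow> carrier Y" "g b = \<zero>\<^bsub>Y\<^esub>"
    using g by (auto simp: based_contraction_def)
  then have g': "g \<in> M - {b} \<rightarrow> carrier Y"
    by auto
  have "p_seminormed p F"
  proof (rule p_seminormed.intro)
    show "0 < p"
      by (rule exponent_pos)
    show "module (ring_of_type_algebra :: 'k ring) F"
      unfolding F_def by (rule module_finite_functions)
    fix u v and c :: 'k
    assume u: "u \<in> carrier F"
    have cl: "lincomb Y g u \<in> carrier Y" if "u \<in> carrier F" for u
      using that by (intro Y.lincomb_closed[OF g']) (auto simp: F_def)
    show "0 \<le> vnorm F u"
      using cl[OF u] by (simp add: F_def N_def)
    show "vnorm F (c \<odot>\<^bsub>F\<^esub> u) = norm c * vnorm F u"
      using u cl[OF u] Y.lincomb_smult[OF g'] by (simp add: F_def N_def Y.vnorm_smult)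
    assume v: "v \<in> carrier F"
    show "vnorm F (u \<oplus>\<^bsub>F\<^esub> v) powr p \<le> vnorm F u powr p + vnorm F v powr p"
      using u v cl[OF u] cl[OF v] Y.lincomb_add[OF g']
      by (simp add: F_def N_def Y.vnorm_add_powr)
  qed
  interpret F: p_seminormed p F by fact
  have "N (point_mass b x \<ominus>\<^bsub>F\<^esub> point_mass b y) \<le> d x y" if "x \<in> M" "y \<in> M" for x y
  proof -
    have pm: "point_mass b z \<in> carrier F" "lincomb Y g (point_mass b z) = g z" if "z \<in> M" for z
      using that point_mass_closed[of z M b N] gM
      by (auto simp: F_def intro!: Y.lincomb_point_mass)
    have "lincomb Y g (point_mass b x \<ominus>\<^bsub>F\<^esub> point_mass b y)
      = lincomb Y g (\<lambda>z. point_mass b x z + (- 1) * point_mass b y z)"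
      using pm that by (simp add: a_minus_def F.minus_eq_smult) (simp add: F_def)
    also have "\<dots> = lincomb Y g (point_mass b x) \<oplus>\<^bsub>Y\<^esub> lincomb Y g (\<lambda>z. (- 1) * point_mass b y z)"
      using pm(1)[OF that(1)] pm(1)[OF that(2)]
      by (intro Y.lincomb_add[OF g']) (auto simp: F_def)
    also have "lincomb Y g (\<lambda>z. (- 1) * point_mass b y z) = (- 1) \<odot>\<^bsub>Y\<^esub> lincomb Y g (point_mass b y)"
      using pm(1)[OF that(2)] by (intro Y.lincomb_smult[OF g']) (auto simp: F_def)
    also have "lincomb Y g (point_mass b x) \<oplus>\<^bsub>Y\<^esub> (- 1) \<odot>\<^bsub>Y\<^esub> lincomb Y g (point_mass b y)
        = g x \<oplus>\<^bsub>Y\<^esub> (- 1) \<odot>\<^bsub>Y\<^esub> g y"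
      using pm(2) that by simp
    also have "\<dots> = g x \<ominus>\<^bsub>Y\<^esub> g y"
      using gM that by (subst Y.minus_eq_smult[symmetric]) (auto simp: a_minus_def)
    finally show ?thesis
      using g that by (simp add: N_def based_contraction_def)
  qed
  note realization = p_Banach_realization[OF \<open>p_seminormed p F\<close>[unfolded F_def] this[unfolded F_def],
      folded F_def]
  obtain E :: "('k, (nat \<Rightarrow> 'm \<Rightarrow> 'k) set) normed_module" and f
    where E: "p_Banach_space p E" "based_contraction M d b E f"
    and "\<forall>a\<in>carrier F. vnorm E (lincomb E f a) = N a"
    using realization by blast
  moreover have "a \<in> carrier F"
    using a by (simp add: F_def)
  ultimately have "vnorm Y (lincomb Y g a) = vnorm E (lincomb E f a)"
    by (simp add: N_def)
  also have "\<dots> \<le> free_norm p M d b a"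
    unfolding free_norm_eq_Sup_lincomb
    using E a by (intro cSup_upper free_norm_set_bdd_above) auto
  finally show ?thesis .
qed

lemma free_norm_set_nonempty:
  "{vnorm E (lincomb E f a) | (E :: ('k::real_normed_field, (nat \<Rightarrow> 'm \<Rightarrow> 'k) set) normed_module) f.
       p_Banach_space p E \<and> based_contraction M d b E f} \<noteq> {}"
proof -
  \<comment> \<open>The zero seminorm is admissible, so the set is inhabited.\<close>
  have "p_seminormed p (finite_functions (M - {b}) (\<lambda>_. 0) :: ('k, _) normed_module)"
    using exponent_pos by (intro p_seminormed.intro module_finite_functions) auto
  from p_Banach_realization[OF this]
  have "\<exists>(E :: ('k, (nat \<Rightarrow> 'm \<Rightarrow> 'k) set) normed_module) f.
    p_Banach_space p E \<and> based_contraction M d b E f"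
    using nonneg by blast
  then show ?thesis
    by blast
qed

text \<open>
  The counterpart of \<open>vnorm_lincomb_le_free_norm\<close>: an upper bound for the free norm need only be
  checked on contractions into \<open>p\<close>-seminormed spaces.
\<close>

lemma free_norm_leI:
  fixes a :: "'m \<Rightarrow> 'k::real_normed_field"
  assumes "\<And>(E :: ('k, (nat \<Rightarrow> 'm \<Rightarrow> 'k) set) normed_module) f.
    p_seminormed p E \<Longrightarrow> based_contraction M d b E f \<Longrightarrow> vnorm E (lincomb E f a) \<le> C"
  shows "free_norm p M d b a \<le> C"
  unfolding free_norm_eq_Sup_lincomb
  using assms p_seminormed_if_p_Banach[OF exponent_pos]
  by (intro cSup_least free_norm_set_nonempty) blast

lemma finite_free_space_simps [simp]:
  "carrier (finite_free_space p M d b) = carrier (finite_functions (M - {b}) N)"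
  "\<zero>\<^bsub>finite_free_space p M d b\<^esub> = (\<lambda>x. 0)"
  "a \<oplus>\<^bsub>finite_free_space p M d b\<^esub> a' = (\<lambda>x. a x + a' x)"
  "c \<odot>\<^bsub>finite_free_space p M d b\<^esub> a = (\<lambda>x. c * a x)"
  "vnorm (finite_free_space p M d b) = free_norm p M d b"
  by (simp_all add: finite_free_space_def)

text \<open>
  A supremum of \<open>p\<close>-seminorms is a \<open>p\<close>-seminorm. Only the inequality \<open>N (c a) \<le> |c| N a\<close> is read off
  from the supremum; the reverse one is the same inequality for \<open>inverse c\<close>.
\<close>

lemma p_seminormed_finite_free_space:
  "p_seminormed p (finite_free_space p M d b :: ('k::real_normed_field, 'm \<Rightarrow> 'k) normed_module)"
proof (rule p_seminormed.intro)
  let ?F = "finite_free_space p M d b :: ('k, 'm \<Rightarrow> 'k) normed_module"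
  note le = vnorm_lincomb_le_free_norm[where N' = "free_norm p M d b", folded finite_free_space_eq]
  have based: "f \<in> M - {b} \<rightarrow> carrier E" if "based_contraction M d b E f" for E f
    using that by (auto simp: based_contraction_def)
  show "0 < p"
    by (rule exponent_pos)
  show "module (ring_of_type_algebra :: 'k ring) ?F"
    unfolding finite_free_space_eq by (rule module_finite_functions)
  have supp: "finite {x. a x \<noteq> 0}" "{x. a x \<noteq> 0} \<subseteq> M - {b}" if "a \<in> carrier ?F" for a
    using that by (auto simp: finite_free_space_eq)
  have nonneg: "0 \<le> free_norm p M d b a" if "a \<in> carrier ?F" for a
  proof -
    obtain E :: "('k, (nat \<Rightarrow> 'm \<Rightarrow> 'k) set) normed_module" and f
      where E: "p_seminormed p E" "based_contraction M d b E f"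
      using free_norm_set_nonempty p_seminormed_if_p_Banach[OF exponent_pos] by blast
    interpret E: p_seminormed p E by fact
    have "0 \<le> vnorm E (lincomb E f a)"
      using supp[OF that] based[OF E(2)] by (intro E.vnorm_nonneg E.lincomb_closed)
    also have "\<dots> \<le> free_norm p M d b a"
      using le E that by blast
    finally show ?thesis .
  qed
  fix u v and c :: 'k
  assume u: "u \<in> carrier ?F"
  show "0 \<le> vnorm ?F u"
    using nonneg u by simp
  have smult_le: "free_norm p M d b (\<lambda>x. c * a x) \<le> norm c * free_norm p M d b a"
    if a: "a \<in> carrier ?F" for a and c :: 'k
  proof (rule free_norm_leI)
    fix E :: "('k, (nat \<Rightarrow> 'm \<Rightarrow> 'k) set) normed_module" and f
    assume E: "p_seminormed p E" "based_contraction M d b E f"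
    interpret E: p_seminormed p E by fact
    show "vnorm E (lincomb E f (\<lambda>x. c * a x)) \<le> norm c * free_norm p M d b a"
      using le[OF E a] E.lincomb_smult[OF based[OF E(2)] supp[OF a]]
        E.lincomb_closed[OF based[OF E(2)] supp(2)[OF a]]
      by (simp add: E.vnorm_smult mult_left_mono)
  qed
  show "vnorm ?F (c \<odot>\<^bsub>?F\<^esub> u) = norm c * vnorm ?F u"
  proof (cases "c = 0")
    case True
    then show ?thesis
      using smult_le[OF u, of 0] nonneg[of "\<lambda>x. 0"] by (simp add: finite_free_space_def)
  next
    case False
    have "norm c * free_norm p M d b u = norm c * free_norm p M d b (\<lambda>x. inverse c * (c * u x))"
      using False by (simp add: mult.assoc[symmetric])
    also have "\<dots> \<le> norm c * (norm (inverse c) * free_norm p M d b (\<lambda>x. c * u x))"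
      using u False by (intro mult_left_mono smult_le) (auto simp: finite_free_space_def)
    also have "\<dots> = free_norm p M d b (\<lambda>x. c * u x)"
      using False by (simp add: norm_inverse)
    finally show ?thesis
      using smult_le[OF u, of c] by simp
  qed
  assume v: "v \<in> carrier ?F"
  let ?C = "(free_norm p M d b u powr p + free_norm p M d b v powr p) powr (1 / p)"
  have add: "(\<lambda>x. u x + v x) \<in> carrier ?F"
    using finite_support_add[OF supp(1)[OF u] supp(1)[OF v]]
      support_add_subset[OF supp(2)[OF u] supp(2)[OF v]]
    by (simp add: finite_free_space_def)
  have "free_norm p M d b (\<lambda>x. u x + v x) \<le> ?C"
  proof (rule free_norm_leI)
    fix E :: "('k, (nat \<Rightarrow> 'm \<Rightarrow> 'k) set) normed_module" and f
    assume E: "p_seminormed p E" "based_contraction M d b E f"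
    interpret E: p_seminormed p E by fact
    note cl = E.lincomb_closed[OF based[OF E(2)] supp(2)]
    have "vnorm E (lincomb E f (\<lambda>x. u x + v x)) powr p
      \<le> vnorm E (lincomb E f u) powr p + vnorm E (lincomb E f v) powr p"
      using E.lincomb_add[OF based[OF E(2)] supp[OF u] supp[OF v]] cl[OF u] cl[OF v]
      by (simp add: E.vnorm_add_powr)
    also have "\<dots> \<le> free_norm p M d b u powr p + free_norm p M d b v powr p"
      using le[OF E u] le[OF E v] cl[OF u] cl[OF v] exponent_pos
      by (intro add_mono powr_mono2) auto
    also have "\<dots> = ?C powr p"
      using exponent_pos by (simp add: powr_powr)
    finally show "vnorm E (lincomb E f (\<lambda>x. u x + v x)) \<le> ?C"
      using exponent_pos cl[OF add] by (subst (asm) powr_le_iff_le) auto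
  qed
  then have "free_norm p M d b (\<lambda>x. u x + v x) powr p \<le> ?C powr p"
    using nonneg[OF add] exponent_pos by (intro powr_mono2) auto
  then show "vnorm ?F (u \<oplus>\<^bsub>?F\<^esub> v) powr p \<le> vnorm ?F u powr p + vnorm ?F v powr p"
    using exponent_pos by (simp add: powr_powr)
qed

end

section \<open>The universal property of the free p-space\<close>

context p_seminormed
begin

lemma lincomb_two_point_masses:
  assumes g: "g \<in> M \<rightarrow> carrier E" "g b = \<zero>" and "x \<in> M" "y \<in> M"
  shows "lincomb E g (\<lambda>z. c * point_mass b x z + e * point_mass b y z) = c \<odot> g x \<oplus> e \<odot> g y"
proof -
  have g': "g \<in> M - {b} \<rightarrow> carrier E"
    using g by auto
  have supp: "finite {y. c * (point_mass b z y :: 'k) \<noteq> 0}"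
      "{y. c * (point_mass b z y :: 'k) \<noteq> 0} \<subseteq> M - {b}"
      "lincomb E g (\<lambda>y. c * point_mass b z y) = c \<odot> g z"
    if "z \<in> M" for c z
  proof -
    have pm: "finite {y. (point_mass b z y :: 'k) \<noteq> 0}"
        "{y. (point_mass b z y :: 'k) \<noteq> 0} \<subseteq> M - {b}"
      using that by (auto simp: support_point_mass)
    then show "finite {y. c * (point_mass b z y :: 'k) \<noteq> 0}"
      "{y. c * (point_mass b z y :: 'k) \<noteq> 0} \<subseteq> M - {b}"
      by auto
    show "lincomb E g (\<lambda>y. c * point_mass b z y) = c \<odot> g z"
      using lincomb_smult[OF g' pm, of c] lincomb_point_mass[of g z b] g that by (simp add: Pi_iff)
  qed
  show ?thesis
    using lincomb_add[OF g' supp(1,2)[OF assms(3)] supp(1,2)[OF assms(4)]]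
      supp(3)[OF assms(3)] supp(3)[OF assms(4)] by simp
qed

text \<open>
  Splitting \<open>c u - e v = c (u - v) + (c - e) v\<close>. The Lipschitz estimates for \<open>P\<close> and, if \<open>p < 1\<close>,
  for \<open>Q\<close> are instances of this inequality.
\<close>

lemma vnorm_smult_diff_powr_le:
  assumes "u \<in> carrier E" "v \<in> carrier E"
  shows "vnorm E (c \<odot> u \<ominus> e \<odot> v) powr p
    \<le> (norm c * vnorm E (u \<ominus> v)) powr p + (norm (c - e) * vnorm E v) powr p"
proof -
  have "(c - e) \<odot> v = c \<odot> v \<ominus> e \<odot> v"
    using assms smult_l_distr[of c "- e" v] smult_assoc1[of "- 1" e v]
    by (simp add: a_minus_def minus_eq_smult)
  then have "c \<odot> u \<ominus> e \<odot> v = c \<odot> (u \<ominus> v) \<oplus> (c - e) \<odot> v"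
    using assms minus_eq_add_minus[of "c \<odot> u" "c \<odot> v" "e \<odot> v"] by (simp add: smult_minus)
  then show ?thesis
    using vnorm_add_powr[of "c \<odot> (u \<ominus> v)" "(c - e) \<odot> v"] assms by (simp add: vnorm_smult)
qed

end

lemma bounded_operator_id: "bounded_operator E E (\<lambda>u. u)"
  unfolding bounded_operator_def by (auto intro: exI[of _ 1])

lemma bounded_operator_compose:
  assumes "p_seminormed p Y" and S: "bounded_operator E Y S" and T: "bounded_operator Y Z T"
  shows "bounded_operator E Z (\<lambda>u. T (S u))"
proof -
  interpret Y: p_seminormed p Y by fact
  obtain C where C: "\<And>u. u \<in> carrier E \<Longrightarrow> vnorm Y (S u) \<le> C * vnorm E u"
    using S unfolding bounded_operator_def by blast
  obtain C' where C': "\<And>u. u \<in> carrier Y \<Longrightarrow> vnorm Z (T u) \<le> C' * vnorm Y u"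
    using T unfolding bounded_operator_def by blast
  have "vnorm Z (T (S u)) \<le> (\<bar>C'\<bar> * C) * vnorm E u" if u: "u \<in> carrier E" for u
  proof -
    have Su: "S u \<in> carrier Y"
      using bounded_operatorD(1)[OF S u] .
    then have "vnorm Z (T (S u)) \<le> \<bar>C'\<bar> * vnorm Y (S u)"
      using C'[OF Su] by (smt (verit) mult_right_mono Y.vnorm_nonneg)
    also have "\<dots> \<le> \<bar>C'\<bar> * (C * vnorm E u)"
      using C[OF u] by (intro mult_left_mono) auto
    finally show ?thesis by (simp add: mult.assoc)
  qed
  then show ?thesis
    unfolding bounded_operator_def
    using bounded_operatorD[OF S] bounded_operatorD[OF T] by (auto intro!: exI[of _ "\<bar>C'\<bar> * C"])
qed

lemma operator_norm_le:
  assumes "p_seminormed p E" "0 \<le> C" "\<And>u. u \<in> carrier E \<Longrightarrow> vnorm Y (T u) \<le> C * vnorm E u"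
  shows "operator_norm E Y T \<le> C"
proof -
  interpret E: p_seminormed p E by fact
  have "\<zero>\<^bsub>E\<^esub> \<in> {u \<in> carrier E. vnorm E u \<le> 1}"
    by simp
  then show ?thesis
    unfolding operator_norm_def
  proof (intro cSUP_least)
    fix u assume u: "u \<in> {u \<in> carrier E. vnorm E u \<le> 1}"
    then have "vnorm Y (T u) \<le> C * vnorm E u"
      using assms(3) by blast
    also have "\<dots> \<le> C * 1"
      using u assms(2) by (intro mult_left_mono) auto
    finally show "vnorm Y (T u) \<le> C" by simp
  qed blast
qed

lemma operator_norm_nonneg:
  assumes "p_seminormed p E" "p_seminormed p Y" "0 \<le> C"
    and T: "bounded_operator E Y T" "\<And>u. u \<in> carrier E \<Longrightarrow> vnorm Y (T u) \<le> C * vnorm E u"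
  shows "0 \<le> operator_norm E Y T"
proof -
  interpret E: p_seminormed p E by fact
  interpret Y: p_seminormed p Y by fact
  have "0 \<le> vnorm Y (T \<zero>\<^bsub>E\<^esub>)"
    using bounded_operatorD(1)[OF T(1), of "\<zero>\<^bsub>E\<^esub>"] by simp
  also have "\<dots> \<le> operator_norm E Y T"
    unfolding operator_norm_def
  proof (intro cSUP_upper bdd_aboveI2)
    show "\<zero>\<^bsub>E\<^esub> \<in> {u \<in> carrier E. vnorm E u \<le> 1}"
      by simp
    show "vnorm Y (T u) \<le> C" if "u \<in> {u \<in> carrier E. vnorm E u \<le> 1}" for u
    proof -
      have "vnorm Y (T u) \<le> C * vnorm E u"
        using T(2) that by blast
      also have "\<dots> \<le> C * 1"
        using that assms(3) by (intro mult_left_mono) auto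
      finally show ?thesis by simp
    qed
  qed
  finally show ?thesis .
qed

context pointed_metric_exponent
begin

lemma point_mass_closed_free [simp]:
  "x \<in> M \<Longrightarrow> point_mass b x \<in> carrier (finite_free_space p M d b)"
  unfolding finite_free_space_eq by (rule point_mass_closed)

lemma p_Banach_free_space:
  "p_Banach_space p (free_space p M d b :: ('k::real_normed_field, _) normed_module)"
  unfolding free_space_def
  by (rule p_seminormed.p_Banach_completion[OF p_seminormed_finite_free_space])

lemma p_seminormed_free_space:
  "p_seminormed p (free_space p M d b :: ('k::real_normed_field, _) normed_module)"
  by (rule p_seminormed_if_p_Banach[OF exponent_pos p_Banach_free_space])

lemma delta_closed [simp]: "x \<in> M \<Longrightarrow> delta p M d b x \<in> carrier (free_space p M d b)"
  unfolding delta_eq free_space_def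
  by (intro p_seminormed.to_completion_closed[OF p_seminormed_finite_free_space] point_mass_closed_free)

lemma delta_base: "delta p M d b b = \<zero>\<^bsub>free_space p M d b\<^esub>"
  using p_seminormed.to_completion_zero[OF p_seminormed_finite_free_space]
  by (simp add: delta_eq free_space_def finite_free_space_def)

lemma vnorm_delta_combination:
  fixes c e :: "'k::real_normed_field"
  assumes "x \<in> M" "y \<in> M"
  shows "vnorm (free_space p M d b) (c \<odot>\<^bsub>free_space p M d b\<^esub> delta p M d b x
      \<oplus>\<^bsub>free_space p M d b\<^esub> e \<odot>\<^bsub>free_space p M d b\<^esub> delta p M d b y)
    = free_norm p M d b (\<lambda>z. c * point_mass b x z + e * point_mass b y z)"
proof -
  let ?F = "finite_free_space p M d b :: ('k, 'm \<Rightarrow> 'k) normed_module"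
  interpret F: p_seminormed p ?F
    by (rule p_seminormed_finite_free_space)
  have "c \<odot>\<^bsub>completion ?F\<^esub> to_completion ?F (point_mass b x)
      \<oplus>\<^bsub>completion ?F\<^esub> e \<odot>\<^bsub>completion ?F\<^esub> to_completion ?F (point_mass b y)
    = to_completion ?F (c \<odot>\<^bsub>?F\<^esub> point_mass b x \<oplus>\<^bsub>?F\<^esub> e \<odot>\<^bsub>?F\<^esub> point_mass b y)"
    using assms by (simp only: F.to_completion_add F.to_completion_smult F.smult_carrier
        point_mass_closed_free)
  moreover have "c \<odot>\<^bsub>?F\<^esub> point_mass b x \<oplus>\<^bsub>?F\<^esub> e \<odot>\<^bsub>?F\<^esub> point_mass b y \<in> carrier ?F"
    using assms by (intro F.a_closed F.smult_carrier point_mass_closed_free)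
  ultimately show ?thesis
    unfolding delta_eq free_space_def by (simp add: F.vnorm_to_completion)
qed

lemma vnorm_delta_diff_le:
  assumes "x \<in> M" "y \<in> M"
  shows "vnorm (free_space p M d b :: ('k::real_normed_field, _) normed_module)
    (delta p M d b x \<ominus>\<^bsub>free_space p M d b\<^esub> delta p M d b y) \<le> d x y"
proof -
  let ?FM = "free_space p M d b :: ('k, _) normed_module"
  interpret FM: p_seminormed p ?FM
    by (rule p_seminormed_free_space)
  have "delta p M d b x \<ominus>\<^bsub>?FM\<^esub> delta p M d b y
    = 1 \<odot>\<^bsub>?FM\<^esub> delta p M d b x \<oplus>\<^bsub>?FM\<^esub> (- 1) \<odot>\<^bsub>?FM\<^esub> delta p M d b y"
    using assms FM.smult_one by (simp add: a_minus_def FM.minus_eq_smult)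
  then have "vnorm ?FM (delta p M d b x \<ominus>\<^bsub>?FM\<^esub> delta p M d b y)
    = free_norm p M d b (\<lambda>z. 1 * point_mass b x z + (- 1 :: 'k) * point_mass b y z)"
    using assms by (simp only: vnorm_delta_combination)
  also have "\<dots> \<le> d x y"
  proof (rule free_norm_leI)
    fix E :: "('k, (nat \<Rightarrow> 'm \<Rightarrow> 'k) set) normed_module" and f
    assume "p_seminormed p E" and f: "based_contraction M d b E f"
    interpret E: p_seminormed p E by fact
    have "lincomb E f (\<lambda>z. 1 * point_mass b x z + (- 1 :: 'k) * point_mass b y z)
      = 1 \<odot>\<^bsub>E\<^esub> f x \<oplus>\<^bsub>E\<^esub> (- 1) \<odot>\<^bsub>E\<^esub> f y"
      using f assms by (intro E.lincomb_two_point_masses) (auto simp: based_contraction_def)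
    also have "\<dots> = f x \<ominus>\<^bsub>E\<^esub> f y"
      using f assms E.smult_one unfolding based_contraction_def
      by (auto simp: a_minus_def E.minus_eq_smult Pi_iff)
    finally show "vnorm E (lincomb E f (\<lambda>z. 1 * point_mass b x z + (- 1 :: 'k) * point_mass b y z))
      \<le> d x y"
      using f assms by (simp add: based_contraction_def)
  qed
  finally show ?thesis .
qed

lemma vnorm_delta_le:
  assumes "x \<in> M"
  shows "vnorm (free_space p M d b :: ('k::real_normed_field, _) normed_module) (delta p M d b x) \<le> d x b"
proof -
  interpret FM: p_seminormed p "free_space p M d b :: ('k, _) normed_module"
    by (rule p_seminormed_free_space)
  show ?thesis
    using vnorm_delta_diff_le[OF assms base_in, where 'k = 'k] assms by (simp add: delta_base)
qed

lemma bounded_operator_free_space_eqI: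
  fixes Y :: "('k::real_normed_field, 'v) normed_module"
  assumes Y: "p_Banach_space p Y"
    and T: "bounded_operator (free_space p M d b) Y T" "bounded_operator (free_space p M d b) Y T'"
    and eq: "\<And>x. x \<in> M - {b} \<Longrightarrow> T (delta p M d b x) = T' (delta p M d b x)"
    and u: "u \<in> carrier (free_space p M d b)"
  shows "T u = T' u"
proof -
  let ?F = "finite_free_space p M d b :: ('k, 'm \<Rightarrow> 'k) normed_module"
  interpret F: p_seminormed p ?F
    by (rule p_seminormed_finite_free_space)
  note T = T[unfolded free_space_def]
  show ?thesis
  proof (rule F.bounded_operator_completion_eqI[OF Y T _ u[unfolded free_space_def]])
    fix a assume a: "a \<in> carrier ?F"
    show "T (to_completion ?F a) = T' (to_completion ?F a)"
    proof (rule linear_eq_on_finite_functions[where M = M and b = b and N = "free_norm p M d b"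
          and T = "\<lambda>a. T (to_completion ?F a)" and T' = "\<lambda>a. T' (to_completion ?F a)",
          folded finite_free_space_eq, OF p_seminormed_if_p_Banach[OF exponent_pos Y] _ _ _ _ _ _ _ a])
      fix x assume "x \<in> M - {b}"
      then show "T (to_completion ?F (point_mass b x)) = T' (to_completion ?F (point_mass b x))"
        using eq by (simp add: delta_eq)
    qed (use bounded_operatorD[OF T(1)] bounded_operatorD[OF T(2)] in
      \<open>auto simp: F.to_completion_add F.to_completion_smult
        simp del: finite_free_space_simps finite_functions_simps\<close>)
  qed
qed

text \<open>
  The universal property. Dividing \<open>g\<close> by \<open>C\<close> gives a contraction, whose linear extension is dominated by
  the free norm; \<open>bounded_operator_extension\<close> then passes to the completion.
\<close>

lemma lipschitz_extension:
  fixes Y :: "('k::real_normed_field, 'v) normed_module"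
  assumes Y: "p_Banach_space p Y"
    and g: "g \<in> M \<rightarrow> carrier Y" "g b = \<zero>\<^bsub>Y\<^esub>"
    and C: "0 < C" "\<And>x y. x \<in> M \<Longrightarrow> y \<in> M \<Longrightarrow> vnorm Y (g x \<ominus>\<^bsub>Y\<^esub> g y) \<le> C * d x y"
  obtains T where "bounded_operator (free_space p M d b) Y T"
    "\<And>x. x \<in> M \<Longrightarrow> T (delta p M d b x) = g x"
    "\<And>u. u \<in> carrier (free_space p M d b) \<Longrightarrow> vnorm Y (T u) \<le> C * vnorm (free_space p M d b) u"
proof -
  let ?F = "finite_free_space p M d b :: ('k, 'm \<Rightarrow> 'k) normed_module"
  have Y': "p_seminormed p Y"
    using p_seminormed_if_p_Banach[OF exponent_pos Y] .
  interpret F: p_seminormed p ?F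
    by (rule p_seminormed_finite_free_space)
  interpret Y: p_seminormed p Y
    by (rule Y')
  have g': "g \<in> M - {b} \<rightarrow> carrier Y"
    using g by auto
  have supp: "finite {x. a x \<noteq> 0}" "{x. a x \<noteq> 0} \<subseteq> M - {b}" if "a \<in> carrier ?F" for a
    using that by (auto simp: finite_free_space_eq)
  note cl = Y.lincomb_closed[OF g' supp(2)]
  define k where "k = (of_real (1 / C) :: 'k)"
  have k: "k \<noteq> 0" "norm k = 1 / C"
    using C(1) by (auto simp: k_def norm_divide)
  define h where "h x = k \<odot>\<^bsub>Y\<^esub> g x" for x
  have h: "based_contraction M d b Y h"
    unfolding based_contraction_def
  proof (intro conjI ballI)
    show "h \<in> M \<rightarrow> carrier Y" "h b = \<zero>\<^bsub>Y\<^esub>"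
      using g Y.smult_r_null[of k] by (auto simp: h_def Pi_iff)
    fix x y assume xy: "x \<in> M" "y \<in> M"
    then have "vnorm Y (h x \<ominus>\<^bsub>Y\<^esub> h y) = vnorm Y (g x \<ominus>\<^bsub>Y\<^esub> g y) / C"
      using g xy by (simp add: h_def Y.smult_minus[symmetric] Y.vnorm_smult k Pi_iff)
    then show "vnorm Y (h x \<ominus>\<^bsub>Y\<^esub> h y) \<le> d x y"
      using C(2)[OF xy] C(1) by (simp add: divide_le_eq mult.commute)
  qed
  have bound: "vnorm Y (lincomb Y g a) \<le> C * vnorm ?F a" if a: "a \<in> carrier ?F" for a
  proof -
    have gx: "g x \<in> carrier Y" if "a x \<noteq> 0" for x
      using g' supp(2)[OF a] that by blast
    have "lincomb Y h a = lincomb Y g (\<lambda>x. k * a x)"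
      unfolding lincomb_def h_def using k gx Y.smult_assoc1[of "a _" k]
      by (auto intro!: Y.add.finprod_cong' simp: mult.commute[of k])
    also have "\<dots> = k \<odot>\<^bsub>Y\<^esub> lincomb Y g a"
      by (rule Y.lincomb_smult[OF g' supp[OF a]])
    finally have "vnorm Y (lincomb Y g a) / C = vnorm Y (lincomb Y h a)"
      using cl[OF a] k by (simp add: Y.vnorm_smult)
    also have "\<dots> \<le> free_norm p M d b a"
      using vnorm_lincomb_le_free_norm[OF Y' h] a unfolding finite_free_space_eq by blast
    finally show ?thesis
      using C(1) by (simp add: field_simps)
  qed
  have "bounded_operator ?F Y (lincomb Y g)"
    unfolding bounded_operator_def
  proof (intro conjI ballI allI)
    show "lincomb Y g \<in> carrier ?F \<rightarrow> carrier Y"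
      using cl by blast
    show "\<exists>C. \<forall>a\<in>carrier ?F. vnorm Y (lincomb Y g a) \<le> C * vnorm ?F a"
      using bound by blast
    fix u assume u: "u \<in> carrier ?F"
    show "lincomb Y g (c \<odot>\<^bsub>?F\<^esub> u) = c \<odot>\<^bsub>Y\<^esub> lincomb Y g u" for c
      using Y.lincomb_smult[OF g' supp[OF u]] by simp
    fix v assume v: "v \<in> carrier ?F"
    show "lincomb Y g (u \<oplus>\<^bsub>?F\<^esub> v) = lincomb Y g u \<oplus>\<^bsub>Y\<^esub> lincomb Y g v"
      using Y.lincomb_add[OF g' supp[OF u] supp[OF v]] by simp
  qed
  then obtain T where T: "bounded_operator (completion ?F) Y T"
    "\<And>u. u \<in> carrier ?F \<Longrightarrow> T (to_completion ?F u) = lincomb Y g u"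
    "\<And>A. A \<in> carrier (completion ?F) \<Longrightarrow> vnorm Y (T A) \<le> C * vnorm (completion ?F) A"
    using F.bounded_operator_extension[OF Y _ bound] by blast
  have "T (delta p M d b x) = g x" if "x \<in> M" for x
  proof -
    have "T (delta p M d b x) = lincomb Y g (point_mass b x)"
      unfolding delta_eq using that by (intro T(2) point_mass_closed_free)
    also have "\<dots> = g x"
      using g that by (intro Y.lincomb_point_mass) auto
    finally show ?thesis .
  qed
  then show thesis
    using that[of T] T(1,3) unfolding free_space_def by blast
qed

end

section \<open>A lower bound in the free space with exponent one\<close>

text \<open>
  Based contractions into this module are the scalar \<open>1\<close>-Lipschitz functions that vanish at \<open>b\<close>, so that the
  domination by the free norm becomes a duality estimate.
\<close>

definition scalar_module :: "('k::real_normed_field, 'k) normed_module" where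
  "scalar_module = \<lparr>carrier = UNIV, mult = (*), one = 1, zero = 0, add = (+), smult = (*), vnorm = norm\<rparr>"

lemma p_seminormed_scalar_module:
  "p_seminormed 1 (scalar_module :: ('k::real_normed_field, 'k) normed_module)"
proof (rule p_seminormed.intro)
  show "module (ring_of_type_algebra :: 'k ring) scalar_module"
  proof (rule moduleI)
    show "cring (ring_of_type_algebra :: 'k ring)"
      by (rule cring_from_type_algebra)
    show "abelian_group (scalar_module :: ('k, 'k) normed_module)"
      by (rule abelian_groupI)
        (auto simp: scalar_module_def add_ac intro: exI[of _ "- _"] add.left_inverse)
  qed (auto simp: scalar_module_def algebra_simps)
qed (auto simp: scalar_module_def norm_mult norm_triangle_ineq)

text \<open>
  One half of the duality between \<open>F(M)\<close> and Lipschitz functions: evaluating an element of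
  \<open>F(M)\<close> at a \<open>1\<close>-Lipschitz function vanishing at \<open>b\<close> bounds its norm from below.
\<close>

lemma (in Metric_space) lipschitz_functional_bound:
  fixes f :: "'a \<Rightarrow> real" and r s :: real
  assumes "b \<in> M" "x \<in> M" "y \<in> M"
    and f: "f b = 0" "\<And>x y. x \<in> M \<Longrightarrow> y \<in> M \<Longrightarrow> \<bar>f x - f y\<bar> \<le> d x y"
  defines "F \<equiv> free_space 1 M d b :: ('k::real_normed_field, _) normed_module"
  shows "\<bar>r * f x - s * f y\<bar> \<le> vnorm F
    (of_real r \<odot>\<^bsub>F\<^esub> delta 1 M d b x \<ominus>\<^bsub>F\<^esub> of_real s \<odot>\<^bsub>F\<^esub> delta 1 M d b y)"
proof -
  interpret pointed_metric_exponent M d b 1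
    using assms by unfold_locales auto
  interpret F: p_seminormed 1 F
    unfolding F_def by (rule p_seminormed_free_space)
  interpret K: p_seminormed 1 "scalar_module :: ('k, 'k) normed_module"
    by (rule p_seminormed_scalar_module)
  define g where "g x = (of_real (f x) :: 'k)" for x
  have minus: "u \<ominus>\<^bsub>scalar_module\<^esub> v = u - v" for u v :: 'k
    using K.minus_eq_smult[of v] by (simp add: a_minus_def scalar_module_def)
  have g: "g \<in> M \<rightarrow> carrier scalar_module" "g b = \<zero>\<^bsub>scalar_module\<^esub>"
    using f by (auto simp: g_def scalar_module_def)
  have "vnorm scalar_module (g x \<ominus>\<^bsub>scalar_module\<^esub> g y) \<le> d x y" if "x \<in> M" "y \<in> M" for x y
  proof -
    have "vnorm scalar_module (g x \<ominus>\<^bsub>scalar_module\<^esub> g y) = norm (of_real (f x - f y) :: 'k)"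
      unfolding minus by (simp add: g_def scalar_module_def)
    then show ?thesis
      using f(2)[OF that] by (simp only: norm_of_real)
  qed
  then have "based_contraction M d b scalar_module g"
    using g by (simp add: based_contraction_def)
  note le = vnorm_lincomb_le_free_norm[OF p_seminormed_scalar_module this]
  define a where "a = (\<lambda>z. of_real r * point_mass b x z + (- of_real s :: 'k) * point_mass b y z)"
  have delta_y: "delta 1 M d b y \<in> carrier F"
    unfolding F_def using assms by (intro delta_closed)
  have "{z. a z \<noteq> 0} \<subseteq> {x, y} - {b}"
    by (auto simp: a_def point_mass_def split: if_splits)
  then have "a \<in> carrier (finite_functions (M - {b}) N)" for N
    using assms finite_subset[of "{z. a z \<noteq> 0}" "{x, y} - {b}"] by auto
  from le[OF this] have "norm (lincomb scalar_module g a) \<le> free_norm 1 M d b a"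
    by (simp add: scalar_module_def)
  also have "lincomb scalar_module g a = of_real (r * f x - s * f y)"
    unfolding a_def using assms
    by (subst K.lincomb_two_point_masses[OF g]) (simp_all add: scalar_module_def g_def)
  also have "free_norm 1 M d b a = vnorm F
    (of_real r \<odot>\<^bsub>F\<^esub> delta 1 M d b x \<oplus>\<^bsub>F\<^esub> (- of_real s) \<odot>\<^bsub>F\<^esub> delta 1 M d b y)"
    unfolding a_def F_def using assms by (intro vnorm_delta_combination[symmetric])
  also have "(- of_real s) \<odot>\<^bsub>F\<^esub> delta 1 M d b y = \<ominus>\<^bsub>F\<^esub> (of_real s \<odot>\<^bsub>F\<^esub> delta 1 M d b y)"
    using delta_y F.smult_assoc1[of "- 1" "of_real s" "delta 1 M d b y"]
    by (subst F.minus_eq_smult) auto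
  finally show ?thesis
    by (simp only: norm_of_real a_minus_def)
qed

section \<open>The bounded copy\<close>

text \<open>
  After division by \<open>x + y\<close> the claim follows from \<open>t \<le> t\<^sup>p\<close> for \<open>t\<close> between \<open>0\<close> and \<open>1\<close>.
\<close>

lemma powr_add_le_add_powr:
  fixes x y p :: real
  assumes "0 \<le> x" "0 \<le> y" "0 < p" "p \<le> 1"
  shows "(x + y) powr p \<le> x powr p + y powr p"
proof (cases "x + y = 0")
  case False
  define s where "s = x + y"
  have s: "0 < s"
    using assms False by (simp add: s_def)
  have le: "t / s \<le> (t / s) powr p" if "0 \<le> t" "t \<le> s" for t
  proof (cases "t = 0")
    case False
    then show ?thesis
      using that assms s powr_mono'[of p 1 "t / s"] by simp
  qed simp
  have "1 = x / s + y / s"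
    using s by (simp add: s_def add_divide_distrib[symmetric])
  also have "\<dots> \<le> (x / s) powr p + (y / s) powr p"
    using le assms by (intro add_mono) (auto simp: s_def)
  also have "\<dots> = (x powr p + y powr p) / s powr p"
    using assms s by (simp add: powr_divide add_divide_distrib)
  finally show ?thesis
    using s by (simp add: s_def field_simps)
qed (use assms in simp)

lemma Metric_space_norm_dist:
  assumes E: "p_Banach_space 1 E" and S: "S \<subseteq> carrier E"
  shows "Metric_space S (norm_dist E)"
proof -
  interpret E: p_seminormed 1 E
    using E by (simp add: p_seminormed_if_p_Banach)
  show ?thesis
  proof
    show "0 \<le> norm_dist E x y" for x y
      by (simp add: norm_dist_def)
    show "norm_dist E x y = norm_dist E y x" for x y
      by (simp add: norm_dist_def E.vnorm_minus_commute)
    fix x y assume xy: "x \<in> S" "y \<in> S"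
    then have cl: "x \<in> carrier E" "y \<in> carrier E"
      using S by auto
    show "norm_dist E x y = 0 \<longleftrightarrow> x = y"
    proof
      assume "norm_dist E x y = 0"
      then have "vnorm E (x \<ominus>\<^bsub>E\<^esub> y) = 0"
        using cl by (simp add: norm_dist_def)
      then show "x = y"
        using cl p_Banach_limit_unique[OF zero_less_one E, of "\<lambda>_. x" x y] by simp
    qed (use cl in \<open>simp add: norm_dist_def\<close>)
    fix z assume "z \<in> S"
    then show "norm_dist E x z \<le> norm_dist E x y + norm_dist E y z"
      using E.vnorm_diff_triangle[of x y z] cl S by (auto simp: norm_dist_def)
  qed
qed

text \<open>
  The parameters \<open>F1\<close> and \<open>\<mu>\<close> are determined by the others; carrying them as parameters fixes the
  scalar field \<open>'k\<close>, which \<open>M\<close>, \<open>d\<close>, \<open>b\<close> and \<open>\<alpha>\<close> do not mention.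
\<close>

locale lipschitz_weight = Metric_space M d for M :: "'m set" and d +
  fixes b :: 'm and \<alpha> :: "real \<Rightarrow> real"
    and F1 :: "('k::real_normed_field, (nat \<Rightarrow> 'm \<Rightarrow> 'k) set) normed_module"
    and \<mu> :: "'m \<Rightarrow> (nat \<Rightarrow> 'm \<Rightarrow> 'k) set"
  assumes base_in: "b \<in> M"
    and pos: "\<And>t. 0 < t \<Longrightarrow> 0 < \<alpha> t"
    and lipschitz: "\<exists>L. L-lipschitz_on {0<..} \<alpha>"
    and bdd: "bdd_above ((\<lambda>t. t / \<alpha> t) ` {0<..})"
    and F1_eq: "F1 = free_space 1 M d b"
    and \<mu>_eq: "\<mu> = mu M d b \<alpha>"
begin

definition "\<zeta> = zeta d b \<alpha>"

definition "K = K_const \<alpha>"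

text \<open>
  The infimum in \<open>Lip_const\<close> is itself a Lipschitz constant, because every difference quotient is a lower
  bound of the set of Lipschitz constants.
\<close>

lemma Lip_const_bound:
  assumes "0 < s" "0 < t"
  shows "\<bar>\<alpha> s - \<alpha> t\<bar> \<le> Lip_const \<alpha> * \<bar>s - t\<bar>"
proof (cases "s = t")
  case False
  have "\<bar>\<alpha> s - \<alpha> t\<bar> / \<bar>s - t\<bar> \<le> Lip_const \<alpha>"
    unfolding Lip_const_def
  proof (rule cInf_greatest)
    show "{L. L-lipschitz_on {0<..} \<alpha>} \<noteq> {}"
      using lipschitz by auto
    fix L assume "L \<in> {L. L-lipschitz_on {0<..} \<alpha>}"
    then have "\<bar>\<alpha> s - \<alpha> t\<bar> \<le> L * \<bar>s - t\<bar>"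
      using assms lipschitz_onD[of L "{0<..}" \<alpha> s t] by (simp add: dist_real_def)
    then show "\<bar>\<alpha> s - \<alpha> t\<bar> / \<bar>s - t\<bar> \<le> L"
      using False by (simp add: divide_le_eq)
  qed
  then show ?thesis
    using False by (simp add: divide_le_eq)
qed simp

lemma Lip_const_nonneg: "0 \<le> Lip_const \<alpha>"
  using Lip_const_bound[of 1 2] abs_ge_zero[of "\<alpha> 1 - \<alpha> 2"] by simp

lemma D_const_bound: "0 < t \<Longrightarrow> t / \<alpha> t \<le> D_const \<alpha>"
  unfolding D_const_def using bdd by (intro cSUP_upper) auto

lemma D_const_pos: "0 < D_const \<alpha>"
  using D_const_bound[of 1] pos[of 1] divide_pos_pos[of 1 "\<alpha> 1"] by linarith

lemma K_nonneg: "0 \<le> K"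
  using Lip_const_nonneg D_const_pos by (simp add: K_def K_const_def)

lemma zeta_base [simp]: "\<zeta> b = 0"
  by (simp add: \<zeta>_def zeta_def)

lemma zeta_pos: "x \<in> M \<Longrightarrow> x \<noteq> b \<Longrightarrow> 0 < \<zeta> x"
  using base_in by (simp add: \<zeta>_def zeta_def pos)

lemma zeta_nonneg: "x \<in> M \<Longrightarrow> 0 \<le> \<zeta> x"
  using zeta_pos[of x] by (cases "x = b") auto

lemma dist_base_le: "x \<in> M \<Longrightarrow> x \<noteq> b \<Longrightarrow> d x b / \<zeta> x \<le> D_const \<alpha>"
  using D_const_bound[of "d b x"] base_in by (simp add: \<zeta>_def zeta_def commute)

text \<open>
  The first factor is at most the Lipschitz constant of \<open>\<alpha>\<close> times \<open>|d b x - d b y|\<close>, hence times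
  \<open>d x y\<close>, and the second is at most \<open>D\<close>; the product of the two constants is \<open>K\<close>.
\<close>

lemma zeta_diff_bound:
  assumes "x \<in> M" "y \<in> M" "x \<noteq> b" "y \<noteq> b"
  shows "\<bar>\<zeta> x - \<zeta> y\<bar> * (d y b / \<zeta> y) \<le> K * d x y"
proof -
  have "\<bar>\<zeta> x - \<zeta> y\<bar> \<le> Lip_const \<alpha> * \<bar>d b x - d b y\<bar>"
    using assms base_in Lip_const_bound[of "d b x" "d b y"] by (simp add: \<zeta>_def zeta_def)
  also have "\<dots> \<le> Lip_const \<alpha> * d x y"
    using mdist_reverse_triangle[of x b y] assms base_in Lip_const_nonneg
    by (intro mult_left_mono) (auto simp: commute)
  finally have "\<bar>\<zeta> x - \<zeta> y\<bar> * (d y b / \<zeta> y) \<le> (Lip_const \<alpha> * d x y) * D_const \<alpha>"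
    using assms dist_base_le zeta_nonneg Lip_const_nonneg by (intro mult_mono) auto
  then show ?thesis
    by (simp add: K_def K_const_def mult_ac)
qed

sublocale pointed1: pointed_metric_exponent M d b 1
  using base_in by unfold_locales auto

sublocale F1: p_seminormed 1 F1
  unfolding F1_eq by (rule pointed1.p_seminormed_free_space)

lemma p_Banach_F1: "p_Banach_space 1 F1"
  unfolding F1_eq by (rule pointed1.p_Banach_free_space)

lemma delta_F1 [simp]: "x \<in> M \<Longrightarrow> delta 1 M d b x \<in> carrier F1"
  unfolding F1_eq by (rule pointed1.delta_closed)

text \<open>
  The formula also covers \<open>x = b\<close>, where both factors are zero because \<open>1 / 0 = 0\<close>; this avoids treating the distinguished
  point separately.
\<close>

lemma mu_eq_smult: "x \<in> M \<Longrightarrow> \<mu> x = of_real (1 / \<zeta> x) \<odot>\<^bsub>F1\<^esub> delta 1 M d b x"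
  using F1.smult_l_null[of "delta 1 M d b b"] base_in
  by (auto simp: \<mu>_eq mu_def \<zeta>_def zeta_def F1_eq[symmetric] Let_def)

lemma mu_closed [simp]: "x \<in> M \<Longrightarrow> \<mu> x \<in> carrier F1"
  by (simp add: mu_eq_smult)

lemma mu_base: "\<mu> b = \<zero>\<^bsub>F1\<^esub>"
  by (simp add: \<mu>_eq mu_def F1_eq Let_def)

lemma B_set_eq: "B_set M d b \<alpha> = \<mu> ` M"
  by (simp add: B_set_def \<mu>_eq)

lemma norm_dist_mu: "x \<in> M \<Longrightarrow> y \<in> M \<Longrightarrow> norm_dist F1 (\<mu> x) (\<mu> y) = vnorm F1 (\<mu> x \<ominus>\<^bsub>F1\<^esub> \<mu> y)"
  by (simp add: norm_dist_def)

lemma vnorm_mu_le: "x \<in> M \<Longrightarrow> vnorm F1 (\<mu> x) \<le> d x b / \<zeta> x"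
  using pointed1.vnorm_delta_le[where 'k = 'k, of x] zeta_nonneg[of x]
  by (simp add: mu_eq_smult F1.vnorm_smult F1_eq[symmetric] norm_divide divide_right_mono)

lemma Metric_space_B: "Metric_space (\<mu> ` M) (norm_dist F1)"
  using p_Banach_F1 by (rule Metric_space_norm_dist) auto

lemma base_in_B: "\<zero>\<^bsub>F1\<^esub> \<in> \<mu> ` M"
  using base_in mu_base by (metis imageI)

lemma mbounded_B: "Metric_space.mbounded (\<mu> ` M) (norm_dist F1) (\<mu> ` M)"
proof -
  interpret B: Metric_space "\<mu> ` M" "norm_dist F1"
    by (rule Metric_space_B)
  have "norm_dist F1 \<zero>\<^bsub>F1\<^esub> (\<mu> x) \<le> D_const \<alpha>" if x: "x \<in> M" for x
  proof -
    have "norm_dist F1 \<zero>\<^bsub>F1\<^esub> (\<mu> x) = vnorm F1 (\<mu> x)"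
      using x F1.vnorm_minus_commute[of "\<zero>\<^bsub>F1\<^esub>" "\<mu> x"] by (simp add: norm_dist_def)
    also have "\<dots> \<le> D_const \<alpha>"
      using vnorm_mu_le[OF x] dist_base_le[OF x] D_const_pos by (cases "x = b") auto
    finally show ?thesis .
  qed
  then show ?thesis
    unfolding B.mbounded using base_in_B by blast
qed

text \<open>
  For \<open>y \<noteq> b\<close> one has \<open>\<zeta> x (\<mu> x - \<mu> y) = \<delta> x - (\<zeta> x / \<zeta> y) \<delta> y\<close>, which splits into \<open>\<delta> x - \<delta> y\<close> and a multiple of
  \<open>\<delta> y\<close> of norm at most \<open>K \<cdot> d x y\<close>.
\<close>

lemma zeta_mult_mu_dist_le:
  assumes "x \<in> M" "y \<in> M" "x \<noteq> b"
  shows "\<zeta> x * vnorm F1 (\<mu> x \<ominus>\<^bsub>F1\<^esub> \<mu> y) \<le> (1 + K) * d x y"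
proof (cases "y = b")
  case True
  then have "\<zeta> x * vnorm F1 (\<mu> x \<ominus>\<^bsub>F1\<^esub> \<mu> y) = \<zeta> x * vnorm F1 (\<mu> x)"
    using assms by (simp add: mu_base)
  also have "\<dots> \<le> d x y"
    using vnorm_mu_le[OF assms(1)] zeta_pos[OF assms(1,3)] True by (simp add: field_simps)
  also have "\<dots> \<le> (1 + K) * d x y"
    using K_nonneg by (simp add: distrib_right)
  finally show ?thesis .
next
  case False
  let ?r = "\<zeta> x / \<zeta> y" and ?dx = "delta 1 M d b x" and ?dy = "delta 1 M d b y"
  have z: "0 < \<zeta> x" "0 < \<zeta> y"
    using zeta_pos assms False by auto
  have "of_real (\<zeta> x) \<odot>\<^bsub>F1\<^esub> (\<mu> x \<ominus>\<^bsub>F1\<^esub> \<mu> y) = 1 \<odot>\<^bsub>F1\<^esub> ?dx \<ominus>\<^bsub>F1\<^esub> of_real ?r \<odot>\<^bsub>F1\<^esub> ?dy"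
    using assms z F1.smult_assoc1[of "of_real (\<zeta> x)" "of_real (1 / \<zeta> x)" ?dx]
      F1.smult_assoc1[of "of_real (\<zeta> x)" "of_real (1 / \<zeta> y)" ?dy]
    by (simp add: F1.smult_minus mu_eq_smult)
  then have "\<zeta> x * vnorm F1 (\<mu> x \<ominus>\<^bsub>F1\<^esub> \<mu> y) = vnorm F1 (1 \<odot>\<^bsub>F1\<^esub> ?dx \<ominus>\<^bsub>F1\<^esub> of_real ?r \<odot>\<^bsub>F1\<^esub> ?dy)"
    using assms z F1.vnorm_smult[of "\<mu> x \<ominus>\<^bsub>F1\<^esub> \<mu> y" "of_real (\<zeta> x)"] by simp
  also have "\<dots> \<le> 1 * vnorm F1 (?dx \<ominus>\<^bsub>F1\<^esub> ?dy) + \<bar>1 - ?r\<bar> * vnorm F1 ?dy"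
    using F1.vnorm_smult_diff_powr_le[of ?dx ?dy 1 "of_real ?r"] assms
    by (simp add: norm_of_real[where 'a = 'k, of "1 - ?r", simplified])
  also have "\<dots> \<le> 1 * d x y + \<bar>1 - ?r\<bar> * d y b"
    using assms pointed1.vnorm_delta_diff_le[where 'k = 'k, of x y]
      pointed1.vnorm_delta_le[where 'k = 'k, of y]
    by (intro add_mono mult_left_mono) (auto simp: F1_eq)
  also have "\<bar>1 - ?r\<bar> * d y b = \<bar>\<zeta> x - \<zeta> y\<bar> * (d y b / \<zeta> y)"
  proof -
    have "1 - ?r = (\<zeta> y - \<zeta> x) / \<zeta> y"
      using z by (simp add: diff_divide_distrib)
    then show ?thesis
      using z by (simp add: abs_minus_commute)
  qed
  also have "\<dots> \<le> K * d x y"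
    using assms False by (intro zeta_diff_bound)
  finally show ?thesis
    by (simp add: distrib_right)
qed

text \<open>
  The test function \<open>z \<mapsto> d z y - d b y\<close> takes the value \<open>d x y / \<zeta> x + (1 / \<zeta> y - 1 / \<zeta> x) \<cdot> d b y\<close> at
  \<open>\<mu> x - \<mu> y\<close>. The hypothesis makes the second term nonnegative; it costs nothing because the two points
  may be exchanged.
\<close>

lemma mu_dist_lower_bound:
  assumes "x \<in> M" "y \<in> M" "1 / \<zeta> x \<le> 1 / \<zeta> y"
  shows "d x y / \<zeta> x \<le> vnorm F1 (\<mu> x \<ominus>\<^bsub>F1\<^esub> \<mu> y)"
proof -
  define f where "f z = d z y - d b y" for z
  have "\<bar>f u - f v\<bar> \<le> d u v" if "u \<in> M" "v \<in> M" for u v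
    using mdist_reverse_triangle[of u y v] that assms by (simp add: f_def commute)
  then have "\<bar>1 / \<zeta> x * f x - 1 / \<zeta> y * f y\<bar> \<le> vnorm F1 (\<mu> x \<ominus>\<^bsub>F1\<^esub> \<mu> y)"
    using lipschitz_functional_bound[where 'k = 'k, OF base_in assms(1,2), of f "1 / \<zeta> x" "1 / \<zeta> y"]
      assms by (simp only: mu_eq_smult F1_eq) (simp add: f_def)
  moreover have "1 / \<zeta> x * f x - 1 / \<zeta> y * f y = d x y / \<zeta> x + (1 / \<zeta> y - 1 / \<zeta> x) * d b y"
    using assms(2) by (simp add: f_def algebra_simps diff_divide_distrib)
  moreover have "0 \<le> (1 / \<zeta> y - 1 / \<zeta> x) * d b y"
    using assms by (intro mult_nonneg_nonneg) auto
  ultimately show ?thesis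
    by linarith
qed

lemma vnorm_mu_ge:
  assumes "x \<in> M"
  shows "d x b / \<zeta> x \<le> vnorm F1 (\<mu> x)"
proof (cases "x = b")
  case False
  have "\<bar>d u b - d v b\<bar> \<le> d u v" if "u \<in> M" "v \<in> M" for u v
    using mdist_reverse_triangle[of u b v] that base_in by (simp add: commute)
  then have "\<bar>1 / \<zeta> x * d x b - 0 * d b b\<bar> \<le> vnorm F1 (\<mu> x \<ominus>\<^bsub>F1\<^esub> of_real 0 \<odot>\<^bsub>F1\<^esub> delta 1 M d b b)"
    using lipschitz_functional_bound[where 'k = 'k, OF base_in assms base_in, of "\<lambda>z. d z b" "1 / \<zeta> x" 0]
      assms base_in by (simp only: mu_eq_smult F1_eq) simp
  then show ?thesis
    using assms base_in F1.smult_l_null[of "delta 1 M d b b"] zeta_nonneg[OF assms] by simp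
qed (use base_in in simp)


text \<open>
  Splitting off the smaller coefficient \<open>1 / \<zeta> x\<close> leaves \<open>(1 / \<zeta> x) (\<delta> x - \<delta> y)\<close> and a multiple of \<open>\<delta> y\<close>
  of norm at most \<open>K \<cdot> d x y / \<zeta> x\<close>, and \<open>d x y / \<zeta> x\<close> is at most the distance of \<open>\<mu> x\<close> and \<open>\<mu> y\<close>.
  If \<open>x = b\<close> the first vector is zero, and the lower bound for \<open>\<parallel>\<mu> y\<parallel>\<close> suffices.
\<close>

lemma normalized_delta_lipschitz_le:
  assumes xy: "x \<in> M" "y \<in> M" and p: "0 < p" "p \<le> 1"
    and le: "1 / \<zeta> x \<le> 1 / \<zeta> y"
  defines "FM \<equiv> free_space p M d b :: ('k, _) normed_module"
  shows "vnorm FM (of_real (1 / \<zeta> x) \<odot>\<^bsub>FM\<^esub> delta p M d b x \<ominus>\<^bsub>FM\<^esub> of_real (1 / \<zeta> y) \<odot>\<^bsub>FM\<^esub> delta p M d b y)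
    \<le> (1 + K powr p) powr (1 / p) * vnorm F1 (\<mu> x \<ominus>\<^bsub>F1\<^esub> \<mu> y)"
proof -
  interpret pointed: pointed_metric_exponent M d b p
    using base_in p by unfold_locales auto
  interpret FM: p_seminormed p FM
    unfolding FM_def by (rule pointed.p_seminormed_free_space)
  let ?dx = "delta p M d b x" and ?dy = "delta p M d b y" and ?C = "(1 + K powr p) powr (1 / p)"
  let ?N = "vnorm FM (of_real (1 / \<zeta> x) \<odot>\<^bsub>FM\<^esub> ?dx \<ominus>\<^bsub>FM\<^esub> of_real (1 / \<zeta> y) \<odot>\<^bsub>FM\<^esub> ?dy)"
  have dcl: "?dx \<in> carrier FM" "?dy \<in> carrier FM"
    unfolding FM_def using xy by auto
  have dy: "vnorm FM ?dy \<le> d y b"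
    unfolding FM_def using xy(2) by (rule pointed.vnorm_delta_le)
  have "1 powr (1 / p) \<le> ?C"
    using p by (intro powr_mono2) auto
  then have C: "1 \<le> ?C"
    by simp
  show ?thesis
  proof (cases "x = b")
    case True
    have "?N = vnorm FM (\<ominus>\<^bsub>FM\<^esub> (of_real (1 / \<zeta> y) \<odot>\<^bsub>FM\<^esub> ?dy))"
      using True dcl FM.smult_l_null[of ?dx] by (simp add: a_minus_def)
    also have "\<dots> = vnorm FM ?dy / \<zeta> y"
      using dcl zeta_nonneg[OF xy(2)] by (simp add: FM.vnorm_smult norm_divide)
    also have "\<dots> \<le> d y b / \<zeta> y"
      using dy zeta_nonneg[OF xy(2)] by (rule divide_right_mono)
    also have "\<dots> \<le> vnorm F1 (\<mu> y)"
      using xy(2) by (rule vnorm_mu_ge)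
    also have "\<dots> = vnorm F1 (\<mu> x \<ominus>\<^bsub>F1\<^esub> \<mu> y)"
      using True xy(2) by (simp add: mu_base a_minus_def)
    also have "\<dots> \<le> ?C * \<dots>"
      using C xy by (intro mult_right_mono[of 1 ?C, simplified]) auto
    finally show ?thesis .
  next
    case False
    have zx: "0 < \<zeta> x"
      using zeta_pos xy False by auto
    then have "y \<noteq> b"
      using le by auto
    then have zy: "0 < \<zeta> y"
      using zeta_pos xy by auto
    have "norm (of_real (1 / \<zeta> x) - of_real (1 / \<zeta> y) :: 'k) = \<bar>1 / \<zeta> x - 1 / \<zeta> y\<bar>"
      by (metis norm_of_real of_real_diff)
    also have "\<dots> = \<bar>\<zeta> x - \<zeta> y\<bar> / (\<zeta> x * \<zeta> y)"
    proof -
      have "1 / \<zeta> x - 1 / \<zeta> y = (\<zeta> y - \<zeta> x) / (\<zeta> x * \<zeta> y)"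
        using zx zy by (simp add: field_simps)
      then show ?thesis
        using zx zy by (simp add: abs_minus_commute abs_mult)
    qed
    finally have diff: "norm (of_real (1 / \<zeta> x) - of_real (1 / \<zeta> y) :: 'k)
      = \<bar>\<zeta> x - \<zeta> y\<bar> / (\<zeta> x * \<zeta> y)" .
    have "norm (of_real (1 / \<zeta> x) - of_real (1 / \<zeta> y) :: 'k) * vnorm FM ?dy
      \<le> \<bar>\<zeta> x - \<zeta> y\<bar> / (\<zeta> x * \<zeta> y) * d y b"
      unfolding diff using dy zx zy by (intro mult_left_mono) auto
    also have "\<dots> = \<bar>\<zeta> x - \<zeta> y\<bar> * (d y b / \<zeta> y) / \<zeta> x"
      by simp
    also have "\<dots> \<le> K * d x y / \<zeta> x"
      using zeta_diff_bound[OF xy False \<open>y \<noteq> b\<close>] zx by (intro divide_right_mono) auto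
    finally have second: "norm (of_real (1 / \<zeta> x) - of_real (1 / \<zeta> y) :: 'k) * vnorm FM ?dy
      \<le> K * (d x y / \<zeta> x)"
      by simp
    have first: "norm (of_real (1 / \<zeta> x) :: 'k) * vnorm FM (?dx \<ominus>\<^bsub>FM\<^esub> ?dy) \<le> d x y / \<zeta> x"
      using pointed.vnorm_delta_diff_le[where 'k = 'k, OF xy] zx
      by (simp add: FM_def norm_divide divide_right_mono)
    have "?N powr p \<le> (norm (of_real (1 / \<zeta> x) :: 'k) * vnorm FM (?dx \<ominus>\<^bsub>FM\<^esub> ?dy)) powr p
      + (norm (of_real (1 / \<zeta> x) - of_real (1 / \<zeta> y) :: 'k) * vnorm FM ?dy) powr p"
      using dcl by (rule FM.vnorm_smult_diff_powr_le)
    also have "\<dots> \<le> (d x y / \<zeta> x) powr p + (K * (d x y / \<zeta> x)) powr p"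
      using first second dcl p by (intro add_mono powr_mono2) auto
    also have "\<dots> = (1 + K powr p) * (d x y / \<zeta> x) powr p"
      using K_nonneg zx powr_mult[of K "d x y / \<zeta> x" p] by (simp add: distrib_right)
    also have "\<dots> = (?C * (d x y / \<zeta> x)) powr p"
      using zx p powr_mult[of ?C "d x y / \<zeta> x" p] by (simp add: powr_powr)
    finally have "?N \<le> ?C * (d x y / \<zeta> x)"
      using dcl zx p by (subst (asm) powr_le_iff_le) auto
    also have "\<dots> \<le> ?C * vnorm F1 (\<mu> x \<ominus>\<^bsub>F1\<^esub> \<mu> y)"
      using mu_dist_lower_bound[OF xy le] by (intro mult_left_mono) auto
    finally show ?thesis .
  qed
qed

text \<open>
  For \<open>p = 1\<close> the vectors \<open>\<delta> x / \<zeta> x\<close> are the points of \<open>B\<close> themselves, so the constant improves to \<open>1\<close>.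
\<close>

definition Q_bound :: "real \<Rightarrow> real" where
  "Q_bound p = (if p = 1 then 1 else (1 + K powr p) powr (1 / p))"

definition P_bound :: "real \<Rightarrow> real" where
  "P_bound p = (1 + 2 * K powr p) powr (1 / p)"

lemma Q_bound_pos: "0 < Q_bound p"
  using add_pos_nonneg[of 1 "K powr p"] by (auto simp: Q_bound_def)

lemma one_le_P_bound:
  assumes "0 < p"
  shows "1 \<le> P_bound p"
proof -
  have "1 powr (1 / p) \<le> P_bound p"
    unfolding P_bound_def using assms by (intro powr_mono2) auto
  then show ?thesis
    by simp
qed

lemma P_bound_Q_bound: "P_bound p * Q_bound p = C_const p \<alpha>"
  using K_nonneg unfolding K_def by (simp add: P_bound_def Q_bound_def C_const_def K_def mult.commute)

lemma normalized_delta_lipschitz: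
  assumes xy: "x \<in> M" "y \<in> M" and p: "0 < p" "p \<le> 1"
  defines "FM \<equiv> free_space p M d b :: ('k, _) normed_module"
  shows "vnorm FM (of_real (1 / \<zeta> x) \<odot>\<^bsub>FM\<^esub> delta p M d b x \<ominus>\<^bsub>FM\<^esub> of_real (1 / \<zeta> y) \<odot>\<^bsub>FM\<^esub> delta p M d b y)
    \<le> Q_bound p * vnorm F1 (\<mu> x \<ominus>\<^bsub>F1\<^esub> \<mu> y)"
proof (cases "p = 1")
  case True
  then show ?thesis
    using xy by (simp add: mu_eq_smult Q_bound_def FM_def F1_eq)
next
  case False
  interpret pointed: pointed_metric_exponent M d b p
    using base_in p by unfold_locales auto
  interpret FM: p_seminormed p FM
    unfolding FM_def by (rule pointed.p_seminormed_free_space)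
  have dcl: "delta p M d b x \<in> carrier FM" "delta p M d b y \<in> carrier FM"
    unfolding FM_def using xy by auto
  show ?thesis
  proof (cases "1 / \<zeta> x \<le> 1 / \<zeta> y")
    case True
    then show ?thesis
      using normalized_delta_lipschitz_le[OF xy p True] \<open>p \<noteq> 1\<close> by (simp add: Q_bound_def FM_def)
  next
    case False
    then have "1 / \<zeta> y \<le> 1 / \<zeta> x"
      by simp
    from normalized_delta_lipschitz_le[OF xy(2,1) p this] show ?thesis
      using \<open>p \<noteq> 1\<close> dcl xy
      by (simp add: Q_bound_def FM_def[symmetric] FM.vnorm_minus_commute[of _ "_ \<odot>\<^bsub>FM\<^esub> delta p M d b y"]
          F1.vnorm_minus_commute[of _ "\<mu> y"])
  qed
qed

text \<open>
  The first summand of the splitting is bounded by \<open>(1 + K) \<cdot> d x y\<close> and the second by \<open>K \<cdot> d x y\<close>; then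
  \<open>(1 + K)\<^sup>p \<le> 1 + K\<^sup>p\<close>.
\<close>

lemma weighted_delta_lipschitz_le:
  assumes xy: "x \<in> M" "y \<in> M" "x \<noteq> b" and p: "0 < p" "p \<le> 1"
  defines "FB \<equiv> free_space p (\<mu> ` M) (norm_dist F1) \<zero>\<^bsub>F1\<^esub> :: ('k, _) normed_module"
    and "\<delta>B \<equiv> delta p (\<mu> ` M) (norm_dist F1) \<zero>\<^bsub>F1\<^esub>"
  shows "vnorm FB (of_real (\<zeta> x) \<odot>\<^bsub>FB\<^esub> \<delta>B (\<mu> x) \<ominus>\<^bsub>FB\<^esub> of_real (\<zeta> y) \<odot>\<^bsub>FB\<^esub> \<delta>B (\<mu> y))
    \<le> P_bound p * d x y"
proof -
  interpret B: Metric_space "\<mu> ` M" "norm_dist F1"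
    by (rule Metric_space_B)
  interpret pB: pointed_metric_exponent "\<mu> ` M" "norm_dist F1" "\<zero>\<^bsub>F1\<^esub>" p
    using base_in_B p by unfold_locales auto
  interpret FB: p_seminormed p FB
    unfolding FB_def by (rule pB.p_seminormed_free_space)
  let ?u = "\<delta>B (\<mu> x)" and ?v = "\<delta>B (\<mu> y)"
  let ?N = "vnorm FB (of_real (\<zeta> x) \<odot>\<^bsub>FB\<^esub> ?u \<ominus>\<^bsub>FB\<^esub> of_real (\<zeta> y) \<odot>\<^bsub>FB\<^esub> ?v)"
  have cl: "?u \<in> carrier FB" "?v \<in> carrier FB"
    unfolding FB_def \<delta>B_def using xy by auto
  have "norm (of_real (\<zeta> x) :: 'k) * vnorm FB (?u \<ominus>\<^bsub>FB\<^esub> ?v)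
    \<le> \<zeta> x * vnorm F1 (\<mu> x \<ominus>\<^bsub>F1\<^esub> \<mu> y)"
    using pB.vnorm_delta_diff_le[where 'k = 'k, of "\<mu> x" "\<mu> y"] xy zeta_nonneg[OF xy(1)]
    by (simp add: FB_def \<delta>B_def norm_dist_mu mult_left_mono)
  also have "\<dots> \<le> (1 + K) * d x y"
    using xy by (intro zeta_mult_mu_dist_le)
  finally have first: "norm (of_real (\<zeta> x) :: 'k) * vnorm FB (?u \<ominus>\<^bsub>FB\<^esub> ?v) \<le> (1 + K) * d x y" .
  have second: "norm (of_real (\<zeta> x) - of_real (\<zeta> y) :: 'k) * vnorm FB ?v \<le> K * d x y"
  proof (cases "y = b")
    case True
    have "?v = \<zero>\<^bsub>FB\<^esub>"
      unfolding True mu_base \<delta>B_def FB_def by (rule pB.delta_base)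
    then show ?thesis
      using K_nonneg by simp
  next
    case False
    have "vnorm FB ?v \<le> norm_dist F1 (\<mu> y) \<zero>\<^bsub>F1\<^esub>"
      unfolding FB_def \<delta>B_def using xy by (intro pB.vnorm_delta_le) auto
    also have "\<dots> \<le> d y b / \<zeta> y"
      using vnorm_mu_le[OF xy(2)] xy by (simp add: norm_dist_def)
    finally have v: "vnorm FB ?v \<le> d y b / \<zeta> y" .
    have "norm (of_real (\<zeta> x) - of_real (\<zeta> y) :: 'k) = \<bar>\<zeta> x - \<zeta> y\<bar>"
      by (metis norm_of_real of_real_diff)
    then have "norm (of_real (\<zeta> x) - of_real (\<zeta> y) :: 'k) * vnorm FB ?v
      \<le> \<bar>\<zeta> x - \<zeta> y\<bar> * (d y b / \<zeta> y)"
      using v by (simp only: mult_left_mono abs_ge_zero)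
    also have "\<dots> \<le> K * d x y"
      using xy False by (intro zeta_diff_bound)
    finally show ?thesis .
  qed
  have "?N powr p \<le> (norm (of_real (\<zeta> x) :: 'k) * vnorm FB (?u \<ominus>\<^bsub>FB\<^esub> ?v)) powr p
    + (norm (of_real (\<zeta> x) - of_real (\<zeta> y) :: 'k) * vnorm FB ?v) powr p"
    using cl by (rule FB.vnorm_smult_diff_powr_le)
  also have "\<dots> \<le> ((1 + K) * d x y) powr p + (K * d x y) powr p"
    using first second cl p by (intro add_mono powr_mono2) auto
  also have "\<dots> = ((1 + K) powr p + K powr p) * d x y powr p"
    using K_nonneg powr_mult[of "1 + K" "d x y" p] powr_mult[of K "d x y" p]
    by (simp add: distrib_right[of "(1 + K) powr p"])
  also have "\<dots> \<le> (1 + 2 * K powr p) * d x y powr p"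
    using powr_add_le_add_powr[of 1 K p] K_nonneg p by (intro mult_right_mono) auto
  also have "\<dots> = (P_bound p * d x y) powr p"
    using p by (simp add: P_bound_def powr_mult powr_powr)
  finally show ?thesis
    using cl one_le_P_bound[OF p(1)] p by (subst (asm) powr_le_iff_le) auto
qed

lemma weighted_delta_lipschitz:
  assumes xy: "x \<in> M" "y \<in> M" and p: "0 < p" "p \<le> 1"
  defines "FB \<equiv> free_space p (\<mu> ` M) (norm_dist F1) \<zero>\<^bsub>F1\<^esub> :: ('k, _) normed_module"
    and "\<delta>B \<equiv> delta p (\<mu> ` M) (norm_dist F1) \<zero>\<^bsub>F1\<^esub>"
  shows "vnorm FB (of_real (\<zeta> x) \<odot>\<^bsub>FB\<^esub> \<delta>B (\<mu> x) \<ominus>\<^bsub>FB\<^esub> of_real (\<zeta> y) \<odot>\<^bsub>FB\<^esub> \<delta>B (\<mu> y))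
    \<le> P_bound p * d x y"
proof -
  interpret B: Metric_space "\<mu> ` M" "norm_dist F1"
    by (rule Metric_space_B)
  interpret pB: pointed_metric_exponent "\<mu> ` M" "norm_dist F1" "\<zero>\<^bsub>F1\<^esub>" p
    using base_in_B p by unfold_locales auto
  interpret FB: p_seminormed p FB
    unfolding FB_def by (rule pB.p_seminormed_free_space)
  have cl: "\<delta>B (\<mu> x) \<in> carrier FB" "\<delta>B (\<mu> y) \<in> carrier FB"
    unfolding FB_def \<delta>B_def using xy by auto
  show ?thesis
  proof (cases "x = b")
    case False
    then show ?thesis
      unfolding FB_def \<delta>B_def using xy p by (intro weighted_delta_lipschitz_le)
  next
    case True
    show ?thesis
    proof (cases "y = b")
      case True
      then show ?thesis
        using \<open>x = b\<close> cl base_in by simp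
    next
      case False
      from weighted_delta_lipschitz_le[OF xy(2,1) this p] show ?thesis
        unfolding FB_def[symmetric] \<delta>B_def[symmetric]
        by (subst FB.vnorm_minus_commute) (use cl in \<open>auto simp: commute\<close>)
    qed
  qed
qed

text \<open>
  The map \<open>h\<close> that defines \<open>Q\<close> is given on \<open>B\<close> through a choice of preimages under \<open>\<mu>\<close>. The choice does not
  matter: by the Lipschitz estimate, points with equal image under \<open>\<mu>\<close> have the same vector
  \<open>\<delta> x / \<zeta> x\<close>. The two compositions are bounded operators that agree with the identity on the vectors
  \<open>\<delta> x\<close>, hence everywhere.
\<close>

lemma free_space_isomorphism:
  assumes p: "0 < p" "p \<le> 1"
  defines "FM \<equiv> free_space p M d b :: ('k, _) normed_module"
    and "FB \<equiv> free_space p (\<mu> ` M) (norm_dist F1) \<zero>\<^bsub>F1\<^esub> :: ('k, _) normed_module"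
    and "\<delta>M \<equiv> delta p M d b"
    and "\<delta>B \<equiv> delta p (\<mu> ` M) (norm_dist F1) \<zero>\<^bsub>F1\<^esub>"
  shows "\<exists>P Q.
    unique_bounded_operator FM FB (M - {b}) \<delta>M (\<lambda>x. of_real (\<zeta> x) \<odot>\<^bsub>FB\<^esub> \<delta>B (\<mu> x)) P \<and>
    unique_bounded_operator FB FM (M - {b}) (\<lambda>x. \<delta>B (\<mu> x)) (\<lambda>x. of_real (1 / \<zeta> x) \<odot>\<^bsub>FM\<^esub> \<delta>M x) Q \<and>
    (\<forall>u\<in>carrier FM. Q (P u) = u) \<and> (\<forall>v\<in>carrier FB. P (Q v) = v) \<and>
    operator_norm FM FB P * operator_norm FB FM Q \<le> C_const p \<alpha>"
proof -
  interpret B: Metric_space "\<mu> ` M" "norm_dist F1"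
    by (rule Metric_space_B)
  interpret pM: pointed_metric_exponent M d b p
    using base_in p by unfold_locales auto
  interpret pB: pointed_metric_exponent "\<mu> ` M" "norm_dist F1" "\<zero>\<^bsub>F1\<^esub>" p
    using base_in_B p by unfold_locales auto
  have FM': "p_seminormed p FM" and FM_Banach: "p_Banach_space p FM"
    unfolding FM_def by (rule pM.p_seminormed_free_space pM.p_Banach_free_space)+
  have FB': "p_seminormed p FB" and FB_Banach: "p_Banach_space p FB"
    unfolding FB_def by (rule pB.p_seminormed_free_space pB.p_Banach_free_space)+
  interpret FM: p_seminormed p FM by (rule FM')
  interpret FB: p_seminormed p FB by (rule FB')
  have \<delta>M: "\<delta>M x \<in> carrier FM" and \<delta>B: "\<delta>B (\<mu> x) \<in> carrier FB" if "x \<in> M" for x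
    unfolding FM_def FB_def \<delta>M_def \<delta>B_def using that by auto
  note eqM = pM.bounded_operator_free_space_eqI[where 'k = 'k, folded FM_def \<delta>M_def]
  note eqB = pB.bounded_operator_free_space_eqI[where 'k = 'k, folded FB_def \<delta>B_def]
  define g where "g x = of_real (\<zeta> x) \<odot>\<^bsub>FB\<^esub> \<delta>B (\<mu> x)" for x
  define k where "k x = of_real (1 / \<zeta> x) \<odot>\<^bsub>FM\<^esub> \<delta>M x" for x
  define h where "h w = k (SOME x. x \<in> M \<and> \<mu> x = w)" for w
  have g: "g \<in> M \<rightarrow> carrier FB" "g b = \<zero>\<^bsub>FB\<^esub>"
    using \<delta>B FB.smult_l_null[OF \<delta>B[OF base_in]] by (auto simp: g_def)
  have k: "k x \<in> carrier FM" if "x \<in> M" for x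
    using \<delta>M[OF that] by (simp add: k_def)
  have k_lipschitz: "vnorm FM (k x \<ominus>\<^bsub>FM\<^esub> k y) \<le> Q_bound p * norm_dist F1 (\<mu> x) (\<mu> y)"
    if "x \<in> M" "y \<in> M" for x y
    using normalized_delta_lipschitz[OF that p] that
    by (simp only: k_def FM_def \<delta>M_def norm_dist_mu)
  have h_mu: "h (\<mu> x) = k x" if x: "x \<in> M" for x
  proof -
    define y where "y = (SOME y. y \<in> M \<and> \<mu> y = \<mu> x)"
    have y: "y \<in> M" "\<mu> y = \<mu> x"
      unfolding y_def using someI[of "\<lambda>y. y \<in> M \<and> \<mu> y = \<mu> x" x] x by auto
    have "vnorm FM (k y \<ominus>\<^bsub>FM\<^esub> k x) \<le> 0"
      using k_lipschitz[OF y(1) x] y x by simp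
    then have "vnorm FM (k y \<ominus>\<^bsub>FM\<^esub> k x) = 0"
      using FM.vnorm_nonneg[OF FM.minus_closed[OF k[OF y(1)] k[OF x]]] by linarith
    then have "k y = k x"
      using p_Banach_limit_unique[OF p(1) FM_Banach, of "\<lambda>_. k y" "k y" "k x"] k y x by simp
    then show ?thesis
      by (simp add: h_def y_def)
  qed
  have h: "h \<in> \<mu> ` M \<rightarrow> carrier FM" "h \<zero>\<^bsub>F1\<^esub> = \<zero>\<^bsub>FM\<^esub>"
    using h_mu k h_mu[OF base_in] FM.smult_l_null[OF \<delta>M[OF base_in]]
    by (auto simp: mu_base k_def)
  have P_pos: "0 < P_bound p"
    using one_le_P_bound[OF p(1)] by simp
  obtain P where P: "bounded_operator FM FB P" "\<And>x. x \<in> M \<Longrightarrow> P (\<delta>M x) = g x"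
    "\<And>u. u \<in> carrier FM \<Longrightarrow> vnorm FB (P u) \<le> P_bound p * vnorm FM u"
    using pM.lipschitz_extension[OF FB_Banach g P_pos]
      weighted_delta_lipschitz[OF _ _ p, folded FB_def \<delta>B_def]
    unfolding FM_def \<delta>M_def g_def by blast
  have "vnorm FM (h v \<ominus>\<^bsub>FM\<^esub> h w) \<le> Q_bound p * norm_dist F1 v w"
    if "v \<in> \<mu> ` M" "w \<in> \<mu> ` M" for v w
    using that k_lipschitz h_mu by auto
  then obtain Q where Q: "bounded_operator FB FM Q" "\<And>w. w \<in> \<mu> ` M \<Longrightarrow> Q (\<delta>B w) = h w"
    "\<And>u. u \<in> carrier FB \<Longrightarrow> vnorm FM (Q u) \<le> Q_bound p * vnorm FB u"
    using pB.lipschitz_extension[OF FM_Banach h Q_bound_pos]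
    unfolding FB_def \<delta>B_def by blast
  have Q_mu: "Q (\<delta>B (\<mu> x)) = k x" if "x \<in> M" for x
    using Q(2) h_mu that by simp
  have uP: "unique_bounded_operator FM FB (M - {b}) \<delta>M (\<lambda>x. of_real (\<zeta> x) \<odot>\<^bsub>FB\<^esub> \<delta>B (\<mu> x)) P"
    unfolding unique_bounded_operator_def g_def[symmetric]
  proof (intro conjI ballI allI impI P(1))
    show "P (\<delta>M x) = g x" if "x \<in> M - {b}" for x
      using P(2) that by auto
    fix T u
    assume T: "bounded_operator FM FB T \<and> (\<forall>x\<in>M - {b}. T (\<delta>M x) = g x)" and u: "u \<in> carrier FM"
    show "T u = P u"
      by (rule eqM[OF FB_Banach _ P(1) _ u]) (use T P(2) in auto)
  qed
  have uQ: "unique_bounded_operator FB FM (M - {b}) (\<lambda>x. \<delta>B (\<mu> x))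
      (\<lambda>x. of_real (1 / \<zeta> x) \<odot>\<^bsub>FM\<^esub> \<delta>M x) Q"
    unfolding unique_bounded_operator_def k_def[symmetric]
  proof (intro conjI ballI allI impI Q(1))
    show "Q (\<delta>B (\<mu> x)) = k x" if "x \<in> M - {b}" for x
      using Q_mu that by auto
    fix T u
    assume T: "bounded_operator FB FM T \<and> (\<forall>x\<in>M - {b}. T (\<delta>B (\<mu> x)) = k x)" and u: "u \<in> carrier FB"
    show "T u = Q u"
    proof (rule eqB[OF FM_Banach _ Q(1) _ u])
      fix w assume "w \<in> \<mu> ` M - {\<zero>\<^bsub>F1\<^esub>}"
      then obtain x where "x \<in> M - {b}" "w = \<mu> x"
        using mu_base by auto
      then show "T (\<delta>B w) = Q (\<delta>B w)"
        using T Q_mu by auto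
    qed (use T in blast)
  qed
  have QP: "Q (P u) = u" if u: "u \<in> carrier FM" for u
  proof (rule eqM[OF FM_Banach bounded_operator_compose[OF FB' P(1) Q(1)] bounded_operator_id _ u])
    fix x assume x: "x \<in> M - {b}"
    then have "Q (P (\<delta>M x)) = of_real (\<zeta> x) \<odot>\<^bsub>FM\<^esub> k x"
      using P(2) Q_mu bounded_operatorD(3)[OF Q(1)] \<delta>B by (simp add: g_def)
    also have "\<dots> = \<delta>M x"
      using x zeta_pos[of x] \<delta>M[of x] FM.smult_assoc1[of "of_real (\<zeta> x)" "of_real (1 / \<zeta> x)" "\<delta>M x"]
        FM.smult_one by (simp add: k_def)
    finally show "Q (P (\<delta>M x)) = \<delta>M x" .
  qed
  have PQ: "P (Q v) = v" if v: "v \<in> carrier FB" for v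
  proof (rule eqB[OF FB_Banach bounded_operator_compose[OF FM' Q(1) P(1)] bounded_operator_id _ v])
    fix w assume "w \<in> \<mu> ` M - {\<zero>\<^bsub>F1\<^esub>}"
    then obtain x where x: "x \<in> M" "x \<noteq> b" "w = \<mu> x"
      using mu_base by auto
    then have "P (Q (\<delta>B w)) = of_real (1 / \<zeta> x) \<odot>\<^bsub>FB\<^esub> g x"
      using P(2) Q_mu bounded_operatorD(3)[OF P(1)] \<delta>M by (simp add: k_def)
    also have "\<dots> = \<delta>B w"
      using x zeta_pos[of x] \<delta>B[of x]
        FB.smult_assoc1[of "of_real (1 / \<zeta> x)" "of_real (\<zeta> x)" "\<delta>B (\<mu> x)"]
        FB.smult_one by (simp add: g_def)
    finally show "P (Q (\<delta>B w)) = \<delta>B w" .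
  qed
  have "operator_norm FM FB P * operator_norm FB FM Q \<le> P_bound p * Q_bound p"
    using operator_norm_le[OF FM' _ P(3)] operator_norm_le[OF FB' _ Q(3)] P_pos Q_bound_pos[of p]
      operator_norm_nonneg[OF FB' FM' _ Q(1,3)]
    by (intro mult_mono) (auto simp: less_imp_le)
  then have "operator_norm FM FB P * operator_norm FB FM Q \<le> C_const p \<alpha>"
    by (simp add: P_bound_Q_bound)
  then show ?thesis
    using uP uQ QP PQ by blast
qed

end

lemma bounded_operator_cong:
  assumes "p_seminormed p E" "bounded_operator E Y T" "\<And>u. u \<in> carrier E \<Longrightarrow> T' u = T u"
  shows "bounded_operator E Y T'"
proof -
  interpret E: p_seminormed p E by fact
  show ?thesis
    using assms(2,3) unfolding bounded_operator_def by auto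
qed

lemma isomorphicI:
  assumes "p_seminormed p Y" "bounded_operator E Y P" "bounded_operator Y E Q"
    and "\<forall>u\<in>carrier E. Q (P u) = u" "\<forall>v\<in>carrier Y. P (Q v) = v"
  shows "isomorphic E Y"
proof -
  note cl = bounded_operatorD(1)[OF assms(2)] bounded_operatorD(1)[OF assms(3)]
  have bij: "bij_betw P (carrier E) (carrier Y)"
    using assms(4,5) cl by (intro bij_betwI[of P _ _ Q]) auto
  have inv: "inv_into (carrier E) P v = Q v" if "v \<in> carrier Y" for v
    using assms(5) cl(2) that bij by (intro inv_into_f_eq) (auto simp: bij_betw_def)
  show ?thesis
    unfolding isomorphic_def
    using bounded_operator_cong[OF assms(1,3) inv] assms(2) bij by blast
qed

context lipschitz_weight
begin

lemma isomorphic_free_spaces: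
  assumes p: "0 < p" "p \<le> 1"
  shows "isomorphic (free_space p M d b :: ('k, _) normed_module)
    (free_space p (\<mu> ` M) (norm_dist F1) \<zero>\<^bsub>F1\<^esub>)"
proof -
  interpret pB: pointed_metric_exponent "\<mu> ` M" "norm_dist F1" "\<zero>\<^bsub>F1\<^esub>" p
    using Metric_space_B base_in_B p
    by (intro pointed_metric_exponent.intro pointed_metric_exponent_axioms.intro)
  show ?thesis
    using free_space_isomorphism[OF p] unfolding unique_bounded_operator_def
    by (elim exE conjE) (rule isomorphicI[OF pB.p_seminormed_free_space], assumption+)
qed

end

lemma lipschitz_weightI:
  assumes "Metric_space M d" "b \<in> M" "\<And>t. 0 < t \<Longrightarrow> 0 < \<alpha> t"
    and "\<exists>L. L-lipschitz_on {0<..} \<alpha>" "bdd_above ((\<lambda>t. t / \<alpha> t) ` {0<..})"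
  shows "lipschitz_weight M d b \<alpha> (free_space 1 M d b) (mu M d b \<alpha>)"
  using assms by (intro lipschitz_weight.intro lipschitz_weight_axioms.intro) auto

theorem theorem2p10:
  fixes M :: "'m set" and d :: "'m \<Rightarrow> 'm \<Rightarrow> real" and b :: 'm
  assumes "Metric_space M d" and "b \<in> M"
  shows
    "(\<exists>(B :: (nat \<Rightarrow> 'm \<Rightarrow> 'k::{real_normed_field,banach}) set set) dB bB.
        Metric_space B dB \<and> bB \<in> B \<and> Metric_space.mbounded B dB B \<and>
        (\<forall>p. 0 < p \<and> p \<le> 1 \<longrightarrow>
          isomorphic (free_space p M d b :: ('k, _) normed_module) (free_space p B dB bB)))
     \<and>
     (\<forall>\<alpha>. (\<forall>t>0. 0 < \<alpha> t) \<and> (\<exists>L. L-lipschitz_on {0<..} \<alpha>) \<and>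
           bdd_above ((\<lambda>t. t / \<alpha> t) ` {0<..}) \<longrightarrow>
       (let F\<^sub>1 = (free_space 1 M d b :: ('k, _) normed_module);
            \<zeta> = zeta d b \<alpha>;
            \<mu> = mu M d b \<alpha>;
            B = B_set M d b \<alpha>;
            dB = norm_dist F\<^sub>1;
            bB = \<zero>\<^bsub>F\<^sub>1\<^esub>
        in Metric_space B dB \<and> bB \<in> B \<and> Metric_space.mbounded B dB B \<and>
          (\<forall>p. 0 < p \<and> p \<le> 1 \<longrightarrow>
            (let FM = (free_space p M d b :: ('k, _) normed_module);
                 FB = (free_space p B dB bB :: ('k, _) normed_module);
                 \<delta>M = delta p M d b;
                 \<delta>B = delta p B dB bB
             in \<exists>P Q.
               unique_bounded_operator FM FB (M - {b}) \<delta>M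
                 (\<lambda>x. of_real (\<zeta> x) \<odot>\<^bsub>FB\<^esub> \<delta>B (\<mu> x)) P \<and>
               unique_bounded_operator FB FM (M - {b}) (\<lambda>x. \<delta>B (\<mu> x))
                 (\<lambda>x. of_real (1 / \<zeta> x) \<odot>\<^bsub>FM\<^esub> \<delta>M x) Q \<and>
               (\<forall>u\<in>carrier FM. Q (P u) = u) \<and>
               (\<forall>v\<in>carrier FB. P (Q v) = v) \<and>
               operator_norm FM FB P * operator_norm FB FM Q \<le> C_const p \<alpha>))))"
proof (intro conjI allI impI, goal_cases)
  case 1
  \<comment> \<open>The identity is an admissible weight, so it provides a bounded space for the first assertion.\<close>
  define \<alpha> where "\<alpha> t = t" for t :: real
  have "1-lipschitz_on {0<..} \<alpha>"
    by (auto simp: lipschitz_on_def \<alpha>_def)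
  moreover have "bdd_above ((\<lambda>t. t / \<alpha> t) ` {0<..})"
    by (auto simp: \<alpha>_def)
  ultimately interpret lipschitz_weight M d b \<alpha> "free_space 1 M d b :: ('k, _) normed_module" "mu M d b \<alpha>"
    using assms by (intro lipschitz_weightI) (auto simp: \<alpha>_def)
  show ?case
    using Metric_space_B base_in_B mbounded_B isomorphic_free_spaces by blast
next
  case (2 \<alpha>)
  then interpret lipschitz_weight M d b \<alpha> "free_space 1 M d b :: ('k, _) normed_module" "mu M d b \<alpha>"
    using assms by (intro lipschitz_weightI) auto
  show ?case
    unfolding Let_def B_set_eq \<zeta>_def[symmetric]
    using free_space_isomorphism
    by (intro conjI allI impI Metric_space_B base_in_B mbounded_B) (elim conjE)
qed

end
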